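(* Let $(\mathbb{P}^n,b)$ be an orbifold whose locus is an arrangement $\mathcal{H}=\{H_1,\dots,H_r\}$ of hyperplanes in general position in $\mathbb{P}^n$, with $b(p)=\prod_{i\,:\,p\in H_i}m_i$ for all $p\in\mathbb{P}^n$, where $(m_1,\dots,m_r)\in\mathbb{N}^r$. Put $s_i:=1-\frac1{m_i}$. Then the orbifold Euler number of $(\mathbb{P}^n,b)$ is $$e_{orb}(\mathbb{P}^n,b)=\sum_{j=0}^n(-1)^j(n+1-j)\sum_{\substack{B\subset\{1,\dots,r\}\\|B|=j}}\ \prod_{i\in B}s_i .$$
   Context: $\mathbb{N}$ denotes the positive integers and $\mathbb{P}^n$ is complex projective space. An orbifold $(\mathbb{P}^n,b)$ is $\mathbb{P}^n$ together with a function $b:\mathbb{P}^n\to\mathbb{N}$ that is locally finitely uniformizable: every point has a neighborhood $O$ for which there are a connected complex manifold $M$ and a finite group $G\subset\operatorname{Aut}(M)$ with $M/G\simeq O$, such that $b(p)$ is the order of the stabilizer in $G$ of any point of $M$ over $p$. Its locus is $\operatorname{supp}(b-1)$. Hyperplanes in general position: any $k\le n$ of them intersect in a linear subspace of codimension $k$, and any $n+1$ of them have empty intersection. Orbifold Euler number: $e_{orb}(\mathbb{P}^n,b):=\sum_{S\in\mathcal{S}}e(S)/b(S)$, where $\mathcal{S}$ is the induced stratification of $\mathbb{P}^n$ into strata on which $b$ is constant, $b(S)$ is the value of $b$ on $S$, and $e$ is the topological Euler characteristic. For a hyperplane arrangement, the strata are the sets $A\setminus\bigcup_{i\,:\,A\not\subset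 H_i}H_i$, where $A$ runs over the nonempty intersections of subfamilies of $\mathcal{H}$ (including $A=\mathbb{P}^n$, the empty intersection). *)

theory Defs
  imports
    "HOL-Analysis.Analysis"
    "HOL-Homology.Homology"
    "HOL-Algebra.Bij"
    "HOL-Library.Function_Algebras"
begin

text \<open>As for \<^const>\<open>Euclidean_space\<close>, the space \<open>C^n\<close> consists of the sequences vanishing from
  index \<open>n\<close> on, with the topology induced from the product topology.\<close>

definition cspace :: "nat \<Rightarrow> (nat \<Rightarrow> complex) set"
  where "cspace n = {z. \<forall>i\<ge>n. z i = 0}"

interpretation cvec: vector_space "\<lambda>(c::complex) (z::nat \<Rightarrow> complex) i. c * z i"
  by unfold_locales (auto simp: algebra_simps fun_eq_iff)

text \<open>Complex (Frechet) differentiability at every point of an open subset \<open>U\<close> of \<open>C^n\<close>; the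
  numbers \<open>a i\<close> are the partial derivatives.\<close>

definition holomorphic_fun :: "nat \<Rightarrow> (nat \<Rightarrow> complex) set \<Rightarrow> ((nat \<Rightarrow> complex) \<Rightarrow> complex) \<Rightarrow> bool"
  where "holomorphic_fun n U f \<longleftrightarrow>
    (\<forall>z\<in>U. \<exists>a. ((\<lambda>w. (f w - f z - (\<Sum>i<n. a i * (w i - z i))) /
                      complex_of_real (L2_set (\<lambda>i. cmod (w i - z i)) {..<n})) \<longlongrightarrow> 0) (at z within U))"

definition complex_atlas ::
    "nat \<Rightarrow> 'a topology \<Rightarrow> ('a set \<times> ('a \<Rightarrow> nat \<Rightarrow> complex)) set \<Rightarrow> bool"
  where "complex_atlas n M \<A> \<longleftrightarrow>
    (\<Union>(U,\<phi>)\<in>\<A>. U) = topspace M \<and>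
    (\<forall>(U,\<phi>)\<in>\<A>. openin M U \<and> openin (top_of_set (cspace n)) (\<phi> ` U) \<and>
       homeomorphic_map (subtopology M U) (top_of_set (\<phi> ` U)) \<phi>) \<and>
    (\<forall>(U,\<phi>)\<in>\<A>. \<forall>(V,\<psi>)\<in>\<A>. \<forall>j<n.
       holomorphic_fun n (\<phi> ` (U \<inter> V)) (\<lambda>w. \<psi> (inv_into U \<phi> w) j))"

definition connected_complex_manifold ::
    "nat \<Rightarrow> 'a topology \<Rightarrow> ('a set \<times> ('a \<Rightarrow> nat \<Rightarrow> complex)) set \<Rightarrow> bool"
  where "connected_complex_manifold n M \<A> \<longleftrightarrow>
    Hausdorff_space M \<and> second_countable M \<and> connected_space M \<and> complex_atlas n M \<A>"

definition manifold_holomorphic_fun ::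
    "nat \<Rightarrow> ('a set \<times> ('a \<Rightarrow> nat \<Rightarrow> complex)) set \<Rightarrow> 'a set \<Rightarrow> ('a \<Rightarrow> complex) \<Rightarrow> bool"
  where "manifold_holomorphic_fun n \<A> W f \<longleftrightarrow>
    (\<forall>(U,\<phi>)\<in>\<A>. holomorphic_fun n (\<phi> ` (U \<inter> W)) (\<lambda>w. f (inv_into U \<phi> w)))"

definition manifold_holomorphic_self_map ::
    "nat \<Rightarrow> 'a topology \<Rightarrow> ('a set \<times> ('a \<Rightarrow> nat \<Rightarrow> complex)) set \<Rightarrow> ('a \<Rightarrow> 'a) \<Rightarrow> bool"
  where "manifold_holomorphic_self_map n M \<A> g \<longleftrightarrow>
    continuous_map M M g \<and>
    (\<forall>(V,\<psi>)\<in>\<A>. \<forall>j<n. manifold_holomorphic_fun n \<A> {x \<in> topspace M. g x \<in> V} (\<lambda>x. \<psi> (g x) j))"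

definition complex_automorphisms ::
    "nat \<Rightarrow> 'a topology \<Rightarrow> ('a set \<times> ('a \<Rightarrow> nat \<Rightarrow> complex)) set \<Rightarrow> ('a \<Rightarrow> 'a) set"
  where "complex_automorphisms n M \<A> =
    {g \<in> Bij (topspace M). manifold_holomorphic_self_map n M \<A> g \<and>
       manifold_holomorphic_self_map n M \<A> (inv_into (topspace M) g)}"

text \<open>Points of \<open>P^n\<close> are the lines through the origin in \<open>C^(n+1)\<close>.\<close>

definition cproj :: "nat \<Rightarrow> (nat \<Rightarrow> complex) set set"
  where "cproj n = {L. cvec.subspace L \<and> L \<subseteq> cspace (Suc n) \<and> cvec.dim L = 1}"

definition cline :: "(nat \<Rightarrow> complex) \<Rightarrow> (nat \<Rightarrow> complex) set"
  where "cline z = cvec.span {z}"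

definition cproj_cone :: "nat \<Rightarrow> (nat \<Rightarrow> complex) set set \<Rightarrow> (nat \<Rightarrow> complex) set"
  where "cproj_cone n W = {z \<in> cspace (Suc n) - {0}. cline z \<in> W}"

definition CP :: "nat \<Rightarrow> (nat \<Rightarrow> complex) set topology"
  where "CP n = topology (\<lambda>W. W \<subseteq> cproj n \<and>
           openin (top_of_set (cspace (Suc n) - {0})) (cproj_cone n W))"

lemma subspace_cspace: "cvec.subspace (cspace n)"
  by (auto simp: cvec.subspace_def cspace_def)

lemma cline_in_cproj:
  assumes "z \<in> cspace (Suc n) - {0}"
  shows "cline z \<in> cproj n"
proof -
  have "cvec.independent {z}"
    using assms cvec.dependent_single by blast
  then have "cvec.dim (cvec.span {z}) = 1"
    using cvec.dim_span_eq_card_independent[of "{z}"] by simp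
  moreover have "cvec.span {z} \<subseteq> cspace (Suc n)"
    using assms by (intro cvec.span_minimal subspace_cspace) auto
  ultimately show ?thesis
    by (simp add: cline_def cproj_def)
qed

lemma cproj_eq_image_cline: "cproj n = cline ` (cspace (Suc n) - {0})"
proof
  show "cline ` (cspace (Suc n) - {0}) \<subseteq> cproj n"
    using cline_in_cproj by blast
  show "cproj n \<subseteq> cline ` (cspace (Suc n) - {0})"
  proof
    fix L assume L: "L \<in> cproj n"
    then have sub: "cvec.subspace L" and "cvec.dim L = 1"
      by (auto simp: cproj_def)
    then obtain B where B: "B \<subseteq> L" "cvec.independent B" "L \<subseteq> cvec.span B" "card B = 1"
      by (metis cvec.basis_exists)
    then obtain z where z: "B = {z}"
      by (auto simp: card_1_singleton_iff)
    have "z \<noteq> 0"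
      using B z cvec.dependent_zero by blast
    moreover have "z \<in> cspace (Suc n)"
      using L B z by (auto simp: cproj_def)
    moreover have "L = cline z"
      using B z sub by (simp add: cline_def cvec.span_minimal subset_antisym)
    ultimately show "L \<in> cline ` (cspace (Suc n) - {0})"
      by blast
  qed
qed

lemma openin_CP:
  "openin (CP n) W \<longleftrightarrow>
     W \<subseteq> cproj n \<and> openin (top_of_set (cspace (Suc n) - {0})) (cproj_cone n W)"
proof -
  have Int: "cproj_cone n (S \<inter> T) = cproj_cone n S \<inter> cproj_cone n T" for S T
    by (auto simp: cproj_cone_def)
  have Un: "cproj_cone n (\<Union>\<K>) = \<Union>(cproj_cone n ` \<K>)" for \<K>
    by (auto simp: cproj_cone_def)
  have "istopology (\<lambda>W. W \<subseteq> cproj n \<and>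
           openin (top_of_set (cspace (Suc n) - {0})) (cproj_cone n W))"
    unfolding istopology_def by (auto simp: Int Un)
  then show ?thesis
    by (simp add: CP_def topology_inverse')
qed

lemma topspace_CP: "topspace (CP n) = cproj n"
proof -
  have "cproj_cone n (cproj n) = cspace (Suc n) - {0}"
    using cline_in_cproj by (auto simp: cproj_cone_def)
  then have "openin (CP n) (cproj n)"
    by (simp add: openin_CP)
  then show ?thesis
    by (meson openin_CP openin_subset openin_topspace subset_antisym)
qed

lemma quotient_map_cline: "quotient_map (top_of_set (cspace (Suc n) - {0})) (CP n) cline"
  by (auto simp: quotient_map_def topspace_CP cproj_eq_image_cline openin_CP cproj_cone_def)

text \<open>Holomorphic functions on an open subset \<open>W\<close> of \<open>P^n\<close>: those whose pullback to the cone over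
  \<open>W\<close> is holomorphic.\<close>

definition cproj_holomorphic_fun ::
    "nat \<Rightarrow> (nat \<Rightarrow> complex) set set \<Rightarrow> ((nat \<Rightarrow> complex) set \<Rightarrow> complex) \<Rightarrow> bool"
  where "cproj_holomorphic_fun n W f \<longleftrightarrow>
    holomorphic_fun (Suc n) (cproj_cone n W) (\<lambda>z. f (cline z))"

text \<open>The map \<open>q\<close> induces an isomorphism of the complex space \<open>M/G\<close> (quotient topology,
  \<open>G\<close>-invariant holomorphic functions) with the open subset \<open>O\<close> of \<open>P^n\<close>.\<close>

definition quotient_uniformization ::
    "nat \<Rightarrow> 'a topology \<Rightarrow> ('a set \<times> ('a \<Rightarrow> nat \<Rightarrow> complex)) set \<Rightarrow> ('a \<Rightarrow> 'a) set \<Rightarrow>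
     (nat \<Rightarrow> complex) set set \<Rightarrow> ('a \<Rightarrow> (nat \<Rightarrow> complex) set) \<Rightarrow> bool"
  where "quotient_uniformization n M \<A> G O' q \<longleftrightarrow>
    quotient_map M (subtopology (CP n) O') q \<and>
    (\<forall>x\<in>topspace M. \<forall>y\<in>topspace M. q x = q y \<longleftrightarrow> (\<exists>g\<in>G. g x = y)) \<and>
    (\<forall>W f. openin (CP n) W \<and> W \<subseteq> O' \<longrightarrow>
       (cproj_holomorphic_fun n W f \<longleftrightarrow>
        manifold_holomorphic_fun n \<A> {x \<in> topspace M. q x \<in> W} (\<lambda>x. f (q x))))"

text \<open>Since \<open>M\<close> maps with finite fibres onto a subset of \<open>P^n\<close>, it has dimension \<open>n\<close> and at most
  the cardinality of the continuum; hence, up to isomorphism, its points can be taken from the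
  type \<^typ>\<open>nat \<Rightarrow> complex\<close>. The topology of \<open>M\<close> is not related to that of this type.\<close>

definition projective_orbifold :: "nat \<Rightarrow> ((nat \<Rightarrow> complex) set \<Rightarrow> nat) \<Rightarrow> bool"
  where "projective_orbifold n b \<longleftrightarrow>
    (\<forall>p\<in>cproj n. b p > 0) \<and>
    (\<forall>p\<in>cproj n. \<exists>O' (M :: (nat \<Rightarrow> complex) topology) \<A> G q.
       openin (CP n) O' \<and> p \<in> O' \<and>
       connected_complex_manifold n M \<A> \<and>
       finite G \<and> subgroup G (BijGroup (topspace M)) \<and> G \<subseteq> complex_automorphisms n M \<A> \<and>
       quotient_uniformization n M \<A> G O' q \<and>
       (\<forall>x\<in>topspace M. b (q x) = card {g \<in> G. g x = x}))"

definition orbifold_locus :: "nat \<Rightarrow> ((nat \<Rightarrow> complex) set \<Rightarrow> nat) \<Rightarrow> (nat \<Rightarrow> complex) set set"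
  where "orbifold_locus n b = {p \<in> cproj n. b p \<noteq> 1}"

definition linear_subspace_codim :: "nat \<Rightarrow> nat \<Rightarrow> (nat \<Rightarrow> complex) set set \<Rightarrow> bool"
  where "linear_subspace_codim n k A \<longleftrightarrow>
    (\<exists>V. cvec.subspace V \<and> V \<subseteq> cspace (Suc n) \<and> cvec.dim V + k = Suc n \<and>
         A = {L \<in> cproj n. L \<subseteq> V})"

definition hyperplane_arrangement ::
    "nat \<Rightarrow> 'i set \<Rightarrow> ('i \<Rightarrow> (nat \<Rightarrow> complex) set set) \<Rightarrow> bool"
  where "hyperplane_arrangement n I H \<longleftrightarrow>
    finite I \<and> inj_on H I \<and> (\<forall>i\<in>I. linear_subspace_codim n 1 (H i))"

definition arrangement_flat ::
    "nat \<Rightarrow> ('i \<Rightarrow> (nat \<Rightarrow> complex) set set) \<Rightarrow> 'i set \<Rightarrow> (nat \<Rightarrow> complex) set set"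
  where "arrangement_flat n H B = cproj n \<inter> (\<Inter>i\<in>B. H i)"

definition in_general_position ::
    "nat \<Rightarrow> 'i set \<Rightarrow> ('i \<Rightarrow> (nat \<Rightarrow> complex) set set) \<Rightarrow> bool"
  where "in_general_position n I H \<longleftrightarrow>
    (\<forall>B\<subseteq>I. card B \<le> n \<longrightarrow> linear_subspace_codim n (card B) (arrangement_flat n H B)) \<and>
    (\<forall>B\<subseteq>I. card B = n + 1 \<longrightarrow> arrangement_flat n H B = {})"

definition arrangement_strata ::
    "nat \<Rightarrow> 'i set \<Rightarrow> ('i \<Rightarrow> (nat \<Rightarrow> complex) set set) \<Rightarrow> (nat \<Rightarrow> complex) set set set"
  where "arrangement_strata n I H =
    {A - (\<Union>i\<in>{i\<in>I. \<not> A \<subseteq> H i}. H i) | A. A \<noteq> {} \<and> (\<exists>B\<subseteq>I. A = arrangement_flat n H B)}"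

definition integrally_independent :: "('a, 'b) monoid_scheme \<Rightarrow> 'a set \<Rightarrow> bool"
  where "integrally_independent G B \<longleftrightarrow> finite B \<and> B \<subseteq> carrier G \<and>
    (\<forall>c :: 'a \<Rightarrow> int. finprod G (\<lambda>x. x [^]\<^bsub>G\<^esub> c x) B = \<one>\<^bsub>G\<^esub> \<longrightarrow> (\<forall>x\<in>B. c x = 0))"

text \<open>The following two notions are meaningful for abelian groups of finite rank, and for spaces
  with finitely many nonzero Betti numbers, all of them finite.\<close>

definition abelian_rank :: "('a, 'b) monoid_scheme \<Rightarrow> nat"
  where "abelian_rank G = Sup (card ` {B. integrally_independent G B})"

definition euler_characteristic :: "'a topology \<Rightarrow> int"
  where "euler_characteristic X =
    (\<Sum>p | abelian_rank (homology_group (int p) X) \<noteq> 0.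
       (-1) ^ p * int (abelian_rank (homology_group (int p) X)))"

text \<open>\<open>S\<close> ranges over strata on which \<open>b\<close> is constant, so that \<^term>\<open>b ` S\<close> is a singleton.\<close>

definition orbifold_euler_number :: "'a topology \<Rightarrow> 'a set set \<Rightarrow> ('a \<Rightarrow> nat) \<Rightarrow> real"
  where "orbifold_euler_number X \<S> b =
    (\<Sum>S\<in>\<S>. real_of_int (euler_characteristic (subtopology X S)) / real (the_elem (b ` S)))"

end

theory Submission
  imports Defs
begin

text \<open>
  For subspaces of projective space the Euler characteristic is the linear dimension, and it is
  additive under removing a hyperplane; hence the complement of hyperplanes \<open>H\<^sub>j\<close> (\<open>j \<in> J\<close>) in \<open>P(V)\<close>
  has Euler characteristic \<open>\<Sum>C\<subseteq>J. (-1)^|C| dim (V \<inter> \<Inter>C)\<close>, for any arrangement. Summing these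
  numbers over the strata, with weights \<open>\<Prod>i\<in>B. 1/m\<^sub>i\<close>, and exchanging the sums gives the formula,
  since \<open>\<Prod>i\<in>D. (1/m\<^sub>i - 1)\<close> is the sum of \<open>(-1)^|D - B| \<Prod>i\<in>B. 1/m\<^sub>i\<close> over \<open>B \<subseteq> D\<close>.

  Additivity is needed for affine arrangements only. There a hyperplane has a tube that retracts
  onto it, and the punctured tube is homotopically a product with a circle; covering the circle by
  two arcs, Mayer-Vietoris shows that the punctured tube has Euler characteristic \<open>0\<close>. The passage to
  \<open>P(V)\<close> uses Mayer-Vietoris for a cover by affine charts, so that no homotopies in projective space
  are needed.
\<close>

section \<open>Rank of abelian groups\<close>

text \<open>Finiteness therefore travels with the number through every exact sequence, in whichever
  direction the sequence is used. The obstacle to removing a hyperplane is that those already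
  removed may come arbitrarily close to it, so a tube of constant radius could meet them. The radius
  has to be a continuous function on the hyperplane part. The hyperplane at infinity of an affine
  chart counts as one more member of the arrangement: the value on the slice \<open>f = 1\<close> is
  the alternating sum on \<open>V\<close> minus the one on the kernel of \<open>f\<close>, which is
  deletion and restriction. Hence one formula serves the affine and the projective case. General
  position enters through the dimension \<open>n + 1 - card B\<close> of a flat. As a truncated
  difference it is correct for more than \<open>n\<close> hyperplanes too, and this removes all case
  distinctions from the final summation.\<close>

definition indep_family :: "('a, 'b) monoid_scheme \<Rightarrow> ('i \<Rightarrow> 'a) \<Rightarrow> 'i set \<Rightarrow> bool"
  where "indep_family G g I \<longleftrightarrow> finite I \<and> g \<in> I \<rightarrow> carrier G \<and>
    (\<forall>c :: 'i \<Rightarrow> int. finprod G (\<lambda>i. g i [^]\<^bsub>G\<^esub> c i) I = \<one>\<^bsub>G\<^esub> \<longrightarrow> (\<forall>i\<in>I. c i = 0))"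

lemma indep_familyD:
  assumes "indep_family G g I" "finprod G (\<lambda>i. g i [^]\<^bsub>G\<^esub> (c i :: int)) I = \<one>\<^bsub>G\<^esub>" "i \<in> I"
  shows "c i = 0"
  using assms by (simp add: indep_family_def)

lemma integrally_independent_iff: "integrally_independent G B \<longleftrightarrow> indep_family G (\<lambda>x. x) B"
  by (auto simp: integrally_independent_def indep_family_def)

text \<open>\<open>K\<close> will be a kernel or an image. Measuring it by independent subsets of
  the ambient group avoids forming subgroups.\<close>

definition rank_ge :: "('a, 'b) monoid_scheme \<Rightarrow> 'a set \<Rightarrow> nat \<Rightarrow> bool"
  where "rank_ge G K k \<longleftrightarrow> (\<exists>B\<subseteq>K. integrally_independent G B \<and> card B = k)"

context comm_group
begin

lemma indep_family_subset:
  assumes "indep_family G g I" "J \<subseteq> I"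
  shows "indep_family G g J"
proof -
  have fin: "finite I" "finite J" and g: "g \<in> I \<rightarrow> carrier G"
    using assms finite_subset by (auto simp: indep_family_def)
  have "\<forall>i\<in>J. c i = 0" if c: "finprod G (\<lambda>i. g i [^] c i) J = \<one>" for c :: "_ \<Rightarrow> int"
  proof -
    define d where "d i = (if i \<in> J then c i else 0)" for i
    have "finprod G (\<lambda>i. g i [^] d i) I = finprod G (\<lambda>i. g i [^] c i) J"
      using fin g assms(2) by (intro finprod_mono_neutral_cong_right) (auto simp: d_def)
    then have "\<forall>i\<in>I. d i = 0"
      using assms(1) c by (auto simp: indep_family_def)
    then show ?thesis
      using assms(2) unfolding d_def by (metis subsetD)
  qed
  then show ?thesis
    using fin g assms(2) by (auto simp: indep_family_def)
qed

lemma indep_family_inj_on: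
  assumes "indep_family G g I"
  shows "inj_on g I"
proof (rule inj_onI, rule ccontr)
  fix i j assume ij: "i \<in> I" "j \<in> I" "g i = g j" "i \<noteq> j"
  have ind: "indep_family G g {i, j}"
    using assms ij by (intro indep_family_subset[OF assms]) auto
  have gi: "g i \<in> carrier G" "g j \<in> carrier G"
    using ind by (auto simp: indep_family_def)
  \<comment> \<open>Equal values would satisfy the nontrivial relation with coefficients 1 and
    -1.\<close>
  define c :: "_ \<Rightarrow> int" where "c k = (if k = i then 1 else -1)" for k
  have "finprod G (\<lambda>i. g i [^] c i) {i, j} = g i [^] c i \<otimes> g j [^] c j"
    using ij gi by (subst finprod_insert) auto
  also have "\<dots> = \<one>"
    using ij gi by (simp add: c_def int_pow_neg)
  finally show False
    using ind by (auto simp: indep_family_def c_def split: if_splits)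
qed

lemma indep_family_image:
  assumes "indep_family G g I"
  shows "integrally_independent G (g ` I)"
proof -
  have inj: "inj_on g I" and g: "g \<in> I \<rightarrow> carrier G" "finite I"
    using indep_family_inj_on assms by (auto simp: indep_family_def)
  have "\<forall>x\<in>g ` I. c x = 0" if "finprod G (\<lambda>x. x [^] c x) (g ` I) = \<one>" for c :: "_ \<Rightarrow> int"
  proof -
    have "finprod G (\<lambda>x. x [^] c x) (g ` I) = finprod G (\<lambda>i. g i [^] c (g i)) I"
      using inj g by (subst finprod_reindex) auto
    then have "\<forall>i\<in>I. (c \<circ> g) i = 0"
      using assms that unfolding indep_family_def by (metis comp_apply)
    then show ?thesis by simp
  qed
  then show ?thesis
    using g by (auto simp: integrally_independent_def)
qed

text \<open>Families are easier to build than sets: a homomorphism restricted to a set is one, and a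
  sum type joins two. Independence forces injectivity, so the return to sets keeps the
  cardinality.\<close>

lemma rank_ge_family:
  assumes "indep_family G g I" "g ` I \<subseteq> K"
  shows "rank_ge G K (card I)"
  unfolding rank_ge_def
  using assms indep_family_image indep_family_inj_on by (metis card_image)

lemma rank_ge_mono:
  assumes "rank_ge G K k" "l \<le> k"
  shows "rank_ge G K l"
proof -
  obtain B where B: "B \<subseteq> K" "indep_family G (\<lambda>x. x) B" "card B = k"
    using assms(1) by (auto simp: rank_ge_def integrally_independent_iff)
  obtain C where C: "C \<subseteq> B" "card C = l"
    using assms(2) B(3) by (metis obtain_subset_with_card_n)
  show ?thesis
    using B C indep_family_subset[OF B(2) C(1)]
    by (auto simp: rank_ge_def integrally_independent_iff intro!: exI[of _ C])
qed

text \<open>Written additively, this is the exchange of a double sum. In \<open>rank_ge_hom\<close>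
  it rewrites a relation between kernel elements as a relation between elements of
  \<open>B\<close>.\<close>

lemma finprod_pow_swap:
  assumes fin: "finite D" "finite B" and B: "B \<subseteq> carrier G"
  shows "finprod G (\<lambda>x. (finprod G (\<lambda>y. y [^] c x y) B) [^] (e x :: int)) D =
    finprod G (\<lambda>y. y [^] (\<Sum>x\<in>D. c x y * e x :: int)) B"
  using fin(1)
proof induction
  case empty
  show ?case by (simp add: finprod_one_eqI)
next
  case (insert a D)
  have closed: "finprod G (\<lambda>y. y [^] (c x y::int)) A \<in> carrier G" if "A \<subseteq> B" for x A
    using B that by (intro finprod_closed) auto
  have pow: "finprod G (\<lambda>y. y [^] (c a y::int)) A [^] e a = finprod G (\<lambda>y. y [^] (c a y * e a)) A"
    if "A \<subseteq> B" for A
    using finite_subset[OF that fin(2)] that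
  proof (induction A rule: finite_induct)
    case empty
    show ?case by simp
  next
    case (insert z A)
    have z: "z \<in> carrier G" using insert B by auto
    have A: "A \<subseteq> carrier G" using insert B by auto
    have "finprod G (\<lambda>y. y [^] (c a y::int)) (insert z A) =
      z [^] c a z \<otimes> finprod G (\<lambda>y. y [^] (c a y::int)) A"
      using insert z A by (intro finprod_insert) auto
    also have "\<dots> [^] e a = (z [^] c a z) [^] e a \<otimes> (finprod G (\<lambda>y. y [^] (c a y::int)) A) [^] e a"
      using z closed[of A] insert by (intro int_pow_distrib) auto
    also have "\<dots> = z [^] (c a z * e a) \<otimes> finprod G (\<lambda>y. y [^] (c a y * e a)) A"
      using insert z by (simp add: int_pow_pow)
    also have "\<dots> = finprod G (\<lambda>y. y [^] (c a y * e a)) (insert z A)"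
      using insert z A by (intro finprod_insert[symmetric]) auto
    finally show ?case .
  qed
  have "finprod G (\<lambda>x. (finprod G (\<lambda>y. y [^] c x y) B) [^] (e x :: int)) (insert a D) =
    finprod G (\<lambda>y. y [^] c a y) B [^] e a \<otimes> finprod G (\<lambda>y. y [^] (\<Sum>x\<in>D. c x y * e x)) B"
    using insert closed[of B] by (subst finprod_insert) auto
  also have "\<dots> = finprod G (\<lambda>y. y [^] (c a y * e a) \<otimes> y [^] (\<Sum>x\<in>D. c x y * e x)) B"
    using B by (subst pow) (auto intro!: finprod_multf[symmetric])
  also have "\<dots> = finprod G (\<lambda>y. y [^] (\<Sum>x\<in>insert a D. c x y * e x)) B"
    using B insert by (intro finprod_cong') (auto simp: int_pow_mult)
  finally show ?case .
qed

end

lemma hom_finprod_pow: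
  assumes "comm_group G" "comm_group H" "f \<in> hom G H" "finite I" "g \<in> I \<rightarrow> carrier G"
  shows "f (finprod G (\<lambda>i. g i [^]\<^bsub>G\<^esub> (c i :: int)) I) = finprod H (\<lambda>i. f (g i) [^]\<^bsub>H\<^esub> c i) I"
  using assms(4,5)
proof induction
  case empty
  interpret G: comm_group G by fact
  interpret H: comm_group H by fact
  show ?case using assms(3) by (simp add: hom_one G.is_group H.is_group)
next
  case (insert i I)
  interpret G: comm_group G by fact
  interpret H: comm_group H by fact
  have f: "f x \<in> carrier H" if "x \<in> carrier G" for x
    using assms(3) that by (auto simp: hom_def)
  have "f (finprod G (\<lambda>i. g i [^]\<^bsub>G\<^esub> c i) (insert i I)) =
    f (g i [^]\<^bsub>G\<^esub> c i \<otimes>\<^bsub>G\<^esub> finprod G (\<lambda>i. g i [^]\<^bsub>G\<^esub> c i) I)"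
    using insert by (subst G.finprod_insert) auto
  also have "\<dots> = f (g i) [^]\<^bsub>H\<^esub> c i \<otimes>\<^bsub>H\<^esub> f (finprod G (\<lambda>i. g i [^]\<^bsub>G\<^esub> c i) I)"
  proof -
    have "finprod G (\<lambda>i. g i [^]\<^bsub>G\<^esub> c i) I \<in> carrier G"
      using insert by (intro G.finprod_closed) auto
    then show ?thesis
      using insert assms(3) by (simp add: hom_mult hom_int_pow[OF assms(3)] G.is_group H.is_group)
  qed
  also have "\<dots> = finprod H (\<lambda>i. f (g i) [^]\<^bsub>H\<^esub> c i) (insert i I)"
    using insert f by (subst H.finprod_insert) auto
  finally show ?case .
qed

text \<open>Rank-nullity over the integers, in terms of attained cardinalities so that infinite
  ranks are covered. For the direction from right to left, independent elements of the image are
  lifted: applying \<open>f\<close> to a relation kills the kernel part, so the coefficients of the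
  lifts vanish first and the others after them.\<close>

lemma rank_ge_hom:
  assumes G: "comm_group G" and H: "comm_group H" and f: "f \<in> hom G H"
  shows "rank_ge G (carrier G) k \<longleftrightarrow>
    (\<exists>i j. k = i + j \<and> rank_ge G (kernel G H f) i \<and> rank_ge H (f ` carrier G) j)"
proof
  interpret G: comm_group G by fact
  interpret H: comm_group H by fact
  assume "\<exists>i j. k = i + j \<and> rank_ge G (kernel G H f) i \<and> rank_ge H (f ` carrier G) j"
  then obtain B C where B: "B \<subseteq> kernel G H f" "indep_family G (\<lambda>x. x) B"
    and C: "C \<subseteq> f ` carrier G" "indep_family H (\<lambda>x. x) C" and k: "k = card B + card C"
    by (auto simp: rank_ge_def integrally_independent_iff)
  have fin: "finite B" "finite C" and Bc: "B \<subseteq> carrier G"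
    using B C by (auto simp: indep_family_def kernel_def)
  have Cc: "C \<subseteq> carrier H"
    using C(1) f by (auto simp: hom_def)
  obtain h where h: "\<And>y. y \<in> C \<Longrightarrow> h y \<in> carrier G \<and> f (h y) = y"
  proof -
    have "\<forall>y\<in>C. \<exists>x. x \<in> carrier G \<and> f x = y"
      using C(1) by blast
    then show ?thesis
      using that by (metis (no_types))
  qed
  \<comment> \<open>The disjoint sum as index set saves showing that \<open>B\<close> and the chosen
    lifts do not overlap.\<close>
  define g where "g = case_sum (\<lambda>x. x) h"
  have gB: "g (Inl x) \<in> carrier G" if "x \<in> B" for x
    using Bc that by (auto simp: g_def)
  have gC: "g (Inr y) \<in> carrier G" if "y \<in> C" for y
    using h that by (auto simp: g_def)
  have "\<forall>i\<in>B <+> C. c i = 0"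
    if c: "finprod G (\<lambda>i. g i [^]\<^bsub>G\<^esub> c i) (B <+> C) = \<one>\<^bsub>G\<^esub>" for c :: "_ \<Rightarrow> int"
  proof -
    have "finprod G (\<lambda>i. g i [^]\<^bsub>G\<^esub> c i) (Inl ` B \<union> Inr ` C) =
      finprod G (\<lambda>i. g i [^]\<^bsub>G\<^esub> c i) (Inl ` B) \<otimes>\<^bsub>G\<^esub> finprod G (\<lambda>i. g i [^]\<^bsub>G\<^esub> c i) (Inr ` C)"
      using fin gB gC by (intro G.finprod_Un_disjoint) auto
    also have "finprod G (\<lambda>i. g i [^]\<^bsub>G\<^esub> c i) (Inl ` B) =
        finprod G (\<lambda>x. x [^]\<^bsub>G\<^esub> c (Inl x)) B"
      using fin Bc by (subst G.finprod_reindex) (auto simp: g_def inj_on_def)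
    also have "finprod G (\<lambda>i. g i [^]\<^bsub>G\<^esub> c i) (Inr ` C) =
        finprod G (\<lambda>y. h y [^]\<^bsub>G\<^esub> c (Inr y)) C"
      using fin h by (subst G.finprod_reindex) (auto simp: g_def)
    finally have split: "finprod G (\<lambda>x. x [^]\<^bsub>G\<^esub> c (Inl x)) B \<otimes>\<^bsub>G\<^esub>
        finprod G (\<lambda>y. h y [^]\<^bsub>G\<^esub> c (Inr y)) C = \<one>\<^bsub>G\<^esub>"
      using c by (simp add: Plus_def)
    have cl: "finprod G (\<lambda>x. x [^]\<^bsub>G\<^esub> c (Inl x)) B \<in> carrier G"
        "finprod G (\<lambda>y. h y [^]\<^bsub>G\<^esub> c (Inr y)) C \<in> carrier G"
      using Bc h by (auto intro!: G.finprod_closed)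
    have "f (finprod G (\<lambda>x. x [^]\<^bsub>G\<^esub> c (Inl x)) B) =
        finprod H (\<lambda>x. f x [^]\<^bsub>H\<^esub> c (Inl x)) B"
      using Bc fin by (intro hom_finprod_pow[OF G H f]) auto
    also have "\<dots> = \<one>\<^bsub>H\<^esub>"
      using B(1) by (intro H.finprod_one_eqI) (auto simp: kernel_def)
    finally have fB: "f (finprod G (\<lambda>x. x [^]\<^bsub>G\<^esub> c (Inl x)) B) = \<one>\<^bsub>H\<^esub>" .
    have fone: "f \<one>\<^bsub>G\<^esub> = \<one>\<^bsub>H\<^esub>"
      using hom_one[OF f G.is_group H.is_group] .
    have "f (finprod G (\<lambda>x. x [^]\<^bsub>G\<^esub> c (Inl x)) B) \<otimes>\<^bsub>H\<^esub>
        f (finprod G (\<lambda>y. h y [^]\<^bsub>G\<^esub> c (Inr y)) C) = \<one>\<^bsub>H\<^esub>"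
      unfolding hom_mult[OF f cl, symmetric] split by (rule fone)
    then have fC: "f (finprod G (\<lambda>y. h y [^]\<^bsub>G\<^esub> c (Inr y)) C) = \<one>\<^bsub>H\<^esub>"
      unfolding fB by (subst (asm) H.l_one) (rule hom_in_carrier[OF f cl(2)])
    have fC': "f (finprod G (\<lambda>y. h y [^]\<^bsub>G\<^esub> c (Inr y)) C) =
        finprod H (\<lambda>y. f (h y) [^]\<^bsub>H\<^esub> c (Inr y)) C"
      using h fin by (intro hom_finprod_pow[OF G H f]) (blast | simp)+
    have fC'': "finprod H (\<lambda>y. f (h y) [^]\<^bsub>H\<^esub> c (Inr y)) C =
        finprod H (\<lambda>y. y [^]\<^bsub>H\<^esub> c (Inr y)) C"
    proof (rule H.finprod_cong')
      show "(\<lambda>y. y [^]\<^bsub>H\<^esub> c (Inr y)) \<in> C \<rightarrow> carrier H"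
        using Cc by (intro Pi_I H.int_pow_closed) blast
      show "f (h y) [^]\<^bsub>H\<^esub> c (Inr y) = y [^]\<^bsub>H\<^esub> c (Inr y)" if "y \<in> C" for y
        using h[OF that] by simp
    qed simp
    have "finprod H (\<lambda>y. y [^]\<^bsub>H\<^esub> c (Inr y)) C = \<one>\<^bsub>H\<^esub>"
      using fC unfolding fC' fC'' .
    then have c2: "\<forall>y\<in>C. c (Inr y) = 0"
      using indep_familyD[OF C(2), of "\<lambda>y. c (Inr y)"] by blast
    have "finprod G (\<lambda>y. h y [^]\<^bsub>G\<^esub> c (Inr y)) C = \<one>\<^bsub>G\<^esub>"
      by (rule G.finprod_one_eqI) (simp add: c2)
    then have "finprod G (\<lambda>x. x [^]\<^bsub>G\<^esub> c (Inl x)) B = \<one>\<^bsub>G\<^esub>"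
      using split cl by simp
    then have "\<forall>x\<in>B. c (Inl x) = 0"
      using indep_familyD[OF B(2), of "\<lambda>x. c (Inl x)"] by blast
    then show ?thesis
      using c2 by (metis PlusE)
  qed
  then have "indep_family G g (B <+> C)"
    using fin gB gC by (auto simp: indep_family_def)
  then have "rank_ge G (carrier G) (card (B <+> C))"
    using gB gC by (intro G.rank_ge_family) auto
  then show "rank_ge G (carrier G) k"
    using fin k by (simp add: card_Plus)
next
  interpret G: comm_group G by fact
  interpret H: comm_group H by fact
  assume "rank_ge G (carrier G) k"
  then obtain B where B: "B \<subseteq> carrier G" "indep_family G (\<lambda>x. x) B" "card B = k"
    by (auto simp: rank_ge_def integrally_independent_iff)
  have finB: "finite B"
    using B by (auto simp: indep_family_def)
  \<comment> \<open>A maximal \<open>C \<subseteq> B\<close> with independent images: every other \<open>x \<in> B\<close> satisfies a relation over \<open>C\<close>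
    modulo the kernel, and the resulting kernel elements are independent.\<close>
  define P where "P = {C. C \<subseteq> B \<and> indep_family H f C}"
  have "finite P" "{} \<in> P"
    using finB by (auto simp: P_def indep_family_def)
  then obtain C where C: "C \<in> P" "\<And>C'. C' \<in> P \<Longrightarrow> C \<subseteq> C' \<Longrightarrow> C = C'"
    using finite_has_maximal[of P] by auto
  then have CB: "C \<subseteq> B" "indep_family H f C" "finite C"
    using finB finite_subset by (auto simp: P_def)
  have "\<exists>c. f (finprod G (\<lambda>y. y [^]\<^bsub>G\<^esub> (c y :: int)) B) = \<one>\<^bsub>H\<^esub> \<and> c x \<noteq> 0 \<and> (\<forall>y\<in>B - insert x C. c y = 0)"
    if x: "x \<in> B - C" for x
  proof -
    have "\<not> indep_family H f (insert x C)"
      using C(2)[of "insert x C"] x CB(1) by (auto simp: P_def)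
    moreover have fc: "f \<in> insert x C \<rightarrow> carrier H"
      using f B(1) CB(1) x by (auto simp: hom_def)
    ultimately obtain c :: "_ \<Rightarrow> int" where
      c: "finprod H (\<lambda>y. f y [^]\<^bsub>H\<^esub> c y) (insert x C) = \<one>\<^bsub>H\<^esub>" "\<exists>y\<in>insert x C. c y \<noteq> 0"
      using CB(3) by (auto simp: indep_family_def)
    have cx: "c x \<noteq> 0"
    proof
      assume c0: "c x = 0"
      have ins: "finprod H (\<lambda>y. f y [^]\<^bsub>H\<^esub> c y) (insert x C) =
          f x [^]\<^bsub>H\<^esub> c x \<otimes>\<^bsub>H\<^esub> finprod H (\<lambda>y. f y [^]\<^bsub>H\<^esub> c y) C"
        using x CB fc by (intro H.finprod_insert) auto
      have "finprod H (\<lambda>y. f y [^]\<^bsub>H\<^esub> c y) C = \<one>\<^bsub>H\<^esub>"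
      proof -
        have "finprod H (\<lambda>y. f y [^]\<^bsub>H\<^esub> c y) C \<in> carrier H"
          using fc by (intro H.finprod_closed) auto
        then show ?thesis
          using c(1) c0 ins by simp
      qed
      then show False
        using CB(2) c(2) c0 by (auto simp: indep_family_def)
    qed
    define d where "d y = (if y \<in> insert x C then c y else 0)" for y
    have "f (finprod G (\<lambda>y. y [^]\<^bsub>G\<^esub> d y) B) = finprod H (\<lambda>y. f y [^]\<^bsub>H\<^esub> d y) B"
      using B finB by (intro hom_finprod_pow[OF G H f]) auto
    also have "\<dots> = finprod H (\<lambda>y. f y [^]\<^bsub>H\<^esub> c y) (insert x C)"
      using finB CB x fc by (intro H.finprod_mono_neutral_cong_right) (auto simp: d_def)
    finally show ?thesis
      using c(1) cx by (intro exI[of _ d]) (auto simp: d_def)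
  qed
  then obtain c where c: "\<And>x. x \<in> B - C \<Longrightarrow>
      f (finprod G (\<lambda>y. y [^]\<^bsub>G\<^esub> (c x y :: int)) B) = \<one>\<^bsub>H\<^esub> \<and> c x x \<noteq> 0 \<and> (\<forall>y\<in>B - insert x C. c x y = 0)"
    by metis
  define h where "h x = finprod G (\<lambda>y. y [^]\<^bsub>G\<^esub> (c x y :: int)) B" for x
  have h: "h x \<in> carrier G" for x
    unfolding h_def using B by (intro G.finprod_closed) auto
  have "\<forall>x\<in>B - C. e x = 0"
    if e: "finprod G (\<lambda>x. h x [^]\<^bsub>G\<^esub> e x) (B - C) = \<one>\<^bsub>G\<^esub>" for e :: "_ \<Rightarrow> int"
  proof
    fix z assume z: "z \<in> B - C"
    have "finprod G (\<lambda>x. h x [^]\<^bsub>G\<^esub> e x) (B - C) =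
        finprod G (\<lambda>y. y [^]\<^bsub>G\<^esub> (\<Sum>x\<in>B - C. c x y * e x)) B"
      unfolding h_def using finB B by (intro G.finprod_pow_swap) auto
    then have "\<forall>y\<in>B. (\<Sum>x\<in>B - C. c x y * e x) = 0"
      using indep_familyD[OF B(2), of "\<lambda>y. \<Sum>x\<in>B - C. c x y * e x"] e by simp
    \<comment> \<open>On \<open>B - C\<close> the coefficient matrix is diagonal with nonzero
      diagonal: \<open>c x z = 0\<close> for \<open>x \<noteq> z\<close>, while
      \<open>c z z \<noteq> 0\<close>.\<close>
    then have "0 = (\<Sum>x\<in>B - C. c x z * e x)"
      using z by auto
    also have "\<dots> = (\<Sum>x\<in>B - C. if x = z then c z z * e z else 0)"
      using c z by (intro sum.cong) auto
    also have "\<dots> = c z z * e z"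
      using finB z by simp
    finally show "e z = 0"
      using c[OF z] by auto
  qed
  then have "indep_family G h (B - C)"
    using finB h by (auto simp: indep_family_def)
  moreover have "h ` (B - C) \<subseteq> kernel G H f"
    using c h by (auto simp: kernel_def h_def)
  ultimately have "rank_ge G (kernel G H f) (card (B - C))"
    by (intro G.rank_ge_family)
  moreover have "rank_ge H (f ` carrier G) (card C)"
    using CB B(1) by (intro H.rank_ge_family[where g = f]) auto
  moreover have "k = card (B - C) + card C"
    using B(3) CB finB by (metis card_Diff_subset card_mono le_add_diff_inverse2)
  ultimately show "\<exists>i j. k = i + j \<and> rank_ge G (kernel G H f) i \<and> rank_ge H (f ` carrier G) j"
    by blast
qed

section \<open>Euler characteristics of spaces\<close>

text \<open>Unlike \<^const>\<open>abelian_rank\<close>, whose supremum is junk for unbounded sets, this rank is additive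
  without any finiteness assumption.\<close>

definition erank :: "('a, 'b) monoid_scheme \<Rightarrow> 'a set \<Rightarrow> enat"
  where "erank G K = (SUP k\<in>{k. rank_ge G K k}. enat k)"

lemma rank_ge_0: "comm_group G \<Longrightarrow> rank_ge G K 0"
  unfolding rank_ge_def by (rule exI[of _ "{}"]) (simp add: integrally_independent_def)

text \<open>By \<open>rank_ge_mono\<close> the attained cardinalities are closed downwards, so the
  supremum is determined by its finite lower bounds and equations between ranks become equivalences
  of \<open>rank_ge\<close>.\<close>

lemma le_erank_iff:
  assumes "comm_group G"
  shows "enat k \<le> erank G K \<longleftrightarrow> rank_ge G K k"
proof
  assume le: "enat k \<le> erank G K"
  show "rank_ge G K k"
  proof (rule ccontr)
    assume not: "\<not> rank_ge G K k"
    have "k \<noteq> 0"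
      using not rank_ge_0[OF assms] by metis
    have "j < k" if "rank_ge G K j" for j
      using not comm_group.rank_ge_mono[OF assms that] by (meson leI)
    then have "erank G K \<le> enat (k - 1)"
      unfolding erank_def by (intro SUP_least) fastforce
    then show False
      using le \<open>k \<noteq> 0\<close> by (metis diff_less enat_ord_simps(2) leD less_le_trans not_gr_zero zero_less_one)
  qed
next
  assume "rank_ge G K k"
  then show "enat k \<le> erank G K"
    unfolding erank_def by (intro SUP_upper) simp
qed

lemma enat_eqI:
  fixes x y :: enat
  assumes "\<And>k. enat k \<le> x \<longleftrightarrow> enat k \<le> y"
  shows "x = y"
proof (rule antisym)
  have *: "x \<le> y" if "\<And>k. enat k \<le> x \<Longrightarrow> enat k \<le> y" for x y
  proof (cases x)
    case (enat n)
    then show ?thesis using that[of n] by simp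
  next
    case infinity
    show ?thesis
    proof (cases y)
      case (enat n)
      then show ?thesis using that[of "Suc n"] infinity by simp
    qed simp
  qed
  from *[of x y] *[of y x] assms show "x \<le> y" "y \<le> x" by blast+
qed

text \<open>The right side has the shape of the splitting in \<open>rank_ge_hom\<close>, which
  thereby becomes an equation in \<open>enat\<close>.\<close>

lemma enat_le_add_iff:
  "enat k \<le> x + y \<longleftrightarrow> (\<exists>i j. k = i + j \<and> enat i \<le> x \<and> enat j \<le> y)"
proof
  assume *: "enat k \<le> x + y"
  show "\<exists>i j. k = i + j \<and> enat i \<le> x \<and> enat j \<le> y"
  proof (cases x)
    case (enat m)
    show ?thesis
    proof (cases "k \<le> m")
      case True
      then show ?thesis using enat by (intro exI[of _ k] exI[of _ 0]) (auto simp: zero_enat_def[symmetric])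
    next
      case False
      have "enat (k - m) \<le> y"
        using * enat False by (cases y) auto
      then show ?thesis using enat False by (intro exI[of _ m] exI[of _ "k - m"]) auto
    qed
  next
    case infinity
    then show ?thesis by (intro exI[of _ k] exI[of _ 0]) (auto simp: zero_enat_def[symmetric])
  qed
next
  assume "\<exists>i j. k = i + j \<and> enat i \<le> x \<and> enat j \<le> y"
  then obtain i j where "k = i + j" "enat i \<le> x" "enat j \<le> y" by blast
  then show "enat k \<le> x + y"
    by (metis add_mono plus_enat_simps(1))
qed

lemma erank_hom:
  assumes "comm_group G" "comm_group H" "f \<in> hom G H"
  shows "erank G (carrier G) = erank G (kernel G H f) + erank H (f ` carrier G)"
  using rank_ge_hom[OF assms]
  by (intro enat_eqI) (simp only: enat_le_add_iff le_erank_iff[OF assms(1)] le_erank_iff[OF assms(2)])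

lemma erank_trivial:
  assumes "comm_group G" "K \<subseteq> {\<one>\<^bsub>G\<^esub>}"
  shows "erank G K = 0"
proof -
  interpret comm_group G by fact
  have "\<not> rank_ge G K (Suc k)" for k
  proof
    assume "rank_ge G K (Suc k)"
    then obtain C where C: "C \<subseteq> K" "indep_family G (\<lambda>x. x) C" "card C = Suc k"
      unfolding rank_ge_def integrally_independent_iff by blast
    then have "C = {\<one>\<^bsub>G\<^esub>}"
      using assms by (metis card.empty nat.distinct(1) subset_singletonD subset_trans)
    then show False
      using indep_familyD[OF C(2), of "\<lambda>_. 1" "\<one>\<^bsub>G\<^esub>"] by simp
  qed
  then have "\<not> enat (Suc 0) \<le> erank G K"
    by (simp add: le_erank_iff assms)
  then show ?thesis
    by (cases "erank G K") (simp_all add: zero_enat_def)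
qed

lemma erank_iso:
  assumes "comm_group G" "comm_group H" "G \<cong> H"
  shows "erank G (carrier G) = erank H (carrier H)"
proof -
  interpret G: comm_group G by fact
  interpret H: comm_group H by fact
  obtain f where f: "f \<in> iso G H"
    using assms(3) by (auto simp: is_iso_def)
  then have hom: "f \<in> hom G H" and im: "f ` carrier G = carrier H" and inj: "inj_on f (carrier G)"
    by (auto simp: iso_def bij_betw_def)
  have "kernel G H f \<subseteq> {\<one>\<^bsub>G\<^esub>}"
  proof
    fix x assume "x \<in> kernel G H f"
    then have "x \<in> carrier G" "f x = f \<one>\<^bsub>G\<^esub>"
      using hom_one[OF hom G.is_group H.is_group] by (simp_all add: kernel_def)
    then show "x \<in> {\<one>\<^bsub>G\<^esub>}"
      using inj_onD[OF inj, of x "\<one>\<^bsub>G\<^esub>"] by simp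
  qed
  then have "erank G (kernel G H f) = 0"
    by (rule erank_trivial[OF assms(1)])
  then show ?thesis
    using erank_hom[OF assms(1,2) hom] unfolding im by (simp only: add_0)
qed

lemma erank_integer_group: "erank integer_group UNIV = 1"
proof (rule antisym)
  interpret comm_group integer_group by (rule abelian_integer_group)
  have "finprod integer_group (\<lambda>x. x [^]\<^bsub>integer_group\<^esub> c x) {1} = c 1" for c :: "int \<Rightarrow> int"
    by (subst finprod_insert) auto
  then have "rank_ge integer_group UNIV 1"
    unfolding rank_ge_def
    by (intro exI[of _ "{1}"]) (auto simp: integrally_independent_def)
  then show "1 \<le> erank integer_group UNIV"
    using le_erank_iff[OF abelian_integer_group] by (simp add: one_enat_def)
  have "\<not> rank_ge integer_group UNIV 2"
  proof
    assume "rank_ge integer_group UNIV 2"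
    then obtain x y where "indep_family integer_group (\<lambda>x. x) {x, y}" "x \<noteq> y"
      by (auto simp: rank_ge_def integrally_independent_iff card_2_iff)
    \<comment> \<open>Any two integers satisfy \<open>y * x + (- x) * y = 0\<close>; both
      coefficients vanish only if \<open>x\<close> and \<open>y\<close> are both 0.\<close>
    moreover define c where "c z = (if z = x then y else - x)" for z
    moreover have "finprod integer_group (\<lambda>z. z [^]\<^bsub>integer_group\<^esub> c z) {x, y} = 0"
      using \<open>x \<noteq> y\<close> by (subst finprod_insert) (auto simp: c_def)
    ultimately have "c x = 0" "c y = 0"
      using indep_familyD[of integer_group "\<lambda>x. x" "{x, y}" c] by (metis insertCI one_integer_group)+
    then show False
      using \<open>x \<noteq> y\<close> by (auto simp: c_def)
  qed
  then have "\<not> enat 2 \<le> erank integer_group UNIV"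
    by (simp add: le_erank_iff abelian_integer_group)
  then show "erank integer_group UNIV \<le> 1"
    by (cases "erank integer_group UNIV") (simp_all add: one_enat_def)
qed

text \<open>A finite \<open>erank\<close> makes the set of cardinalities an initial segment, on
  which the supremum of natural numbers is a true maximum.\<close>

lemma abelian_rank_eq:
  assumes "comm_group G" "erank G (carrier G) = enat k"
  shows "abelian_rank G = k"
proof -
  have "card ` {B. integrally_independent G B} = {j. rank_ge G (carrier G) j}"
  proof -
    have "B \<subseteq> carrier G" if "integrally_independent G B" for B
      using that by (simp add: integrally_independent_def)
    then show ?thesis
      unfolding rank_ge_def by blast
  qed
  also have "\<dots> = {..k}"
  proof -
    have "rank_ge G (carrier G) j \<longleftrightarrow> j \<le> k" for j
      using le_erank_iff[OF assms(1), of j "carrier G"] unfolding assms(2) by simp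
    then show ?thesis
      by (simp only: atMost_def)
  qed
  finally show ?thesis
    unfolding abelian_rank_def by (simp only: cSup_atMost)
qed

section \<open>Alternating sums of extended ranks\<close>

definition euler_seq :: "(nat \<Rightarrow> enat) \<Rightarrow> int \<Rightarrow> bool"
  where "euler_seq b e \<longleftrightarrow> (\<exists>N c. (\<forall>p. b p = enat (c p)) \<and> (\<forall>p\<ge>N. c p = 0) \<and>
    e = (\<Sum>p<N. (-1) ^ p * int (c p)))"

text \<open>Every larger bound serves as well, since only zero terms are added. Two sequences can
  then be summed up to a common bound.\<close>

lemma euler_seq_iff:
  "euler_seq b e \<longleftrightarrow> (\<exists>c N. (\<forall>p. b p = enat (c p)) \<and>
    (\<forall>M\<ge>N. c M = 0 \<and> e = (\<Sum>p<M. (-1) ^ p * int (c p))))" (is "_ \<longleftrightarrow> ?rhs")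
proof
  assume "euler_seq b e"
  then obtain N c where c: "\<forall>p. b p = enat (c p)" "\<forall>p\<ge>N. c p = 0"
      "e = (\<Sum>p<N. (-1) ^ p * int (c p))"
    by (auto simp: euler_seq_def)
  have "e = (\<Sum>p<M. (-1) ^ p * int (c p))" if "N \<le> M" for M
    unfolding c(3) using that c(2) by (intro sum.mono_neutral_left) auto
  then show ?rhs
    using c(1,2) by blast
next
  assume ?rhs
  then show "euler_seq b e"
    unfolding euler_seq_def by blast
qed

lemma euler_seq_unique:
  assumes "euler_seq b e" "euler_seq b e'"
  shows "e = e'"
proof -
  obtain c N where c: "\<And>p. b p = enat (c p)"
      "\<And>M. N \<le> M \<Longrightarrow> c M = 0 \<and> e = (\<Sum>p<M. (-1) ^ p * int (c p))"
    using assms(1) unfolding euler_seq_iff by blast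
  obtain c' N' where c': "\<And>p. b p = enat (c' p)"
      "\<And>M. N' \<le> M \<Longrightarrow> c' M = 0 \<and> e' = (\<Sum>p<M. (-1) ^ p * int (c' p))"
    using assms(2) unfolding euler_seq_iff by blast
  have "c = c'"
    using c(1) c'(1) by (metis enat.inject ext)
  then show ?thesis
    using c(2)[of "max N N'"] c'(2)[of "max N N'"] by simp
qed

lemma euler_seq_add:
  assumes "euler_seq b x" "euler_seq d y"
  shows "euler_seq (\<lambda>p. b p + d p) (x + y)"
proof -
  obtain c N where c: "\<And>p. b p = enat (c p)"
      "\<And>M. N \<le> M \<Longrightarrow> c M = 0 \<and> x = (\<Sum>p<M. (-1) ^ p * int (c p))"
    using assms(1) unfolding euler_seq_iff by blast
  obtain c' N' where c': "\<And>p. d p = enat (c' p)"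
      "\<And>M. N' \<le> M \<Longrightarrow> c' M = 0 \<and> y = (\<Sum>p<M. (-1) ^ p * int (c' p))"
    using assms(2) unfolding euler_seq_iff by blast
  have sum: "x + y = (\<Sum>p<max N N'. (-1) ^ p * int (c p + c' p))"
    using c(2)[of "max N N'"] c'(2)[of "max N N'"]
    by (simp add: sum.distrib[symmetric] ring_distribs)
  have "c p + c' p = 0" if "max N N' \<le> p" for p
    using c(2)[of p] c'(2)[of p] that by simp
  then show ?thesis
    unfolding euler_seq_def using c(1) c'(1) sum
    by (intro exI[of _ "max N N'"] exI[of _ "\<lambda>p. c p + c' p"]) simp
qed

text \<open>Through this, the ranks of images in an exact sequence inherit finiteness from the
  homology groups.\<close>

lemma euler_seq_le:
  assumes "euler_seq b x" "\<And>p. d p \<le> b p"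
  obtains y where "euler_seq d y"
proof -
  obtain c N where c: "\<And>p. b p = enat (c p)"
      "\<And>M. N \<le> M \<Longrightarrow> c M = 0 \<and> x = (\<Sum>p<M. (-1) ^ p * int (c p))"
    using assms(1) unfolding euler_seq_iff by blast
  have d: "d p = enat (the_enat (d p)) \<and> the_enat (d p) \<le> c p" for p
    using assms(2)[of p] c(1)[of p] by (cases "d p") auto
  have "euler_seq d (\<Sum>p<N. (-1) ^ p * int (the_enat (d p)))"
    unfolding euler_seq_def
    using d c(2) by (intro exI[of _ N] exI[of _ "\<lambda>p. the_enat (d p)"]) (metis le_zero_eq)
  then show ?thesis
    using that by blast
qed

lemma euler_seq_add_parts:
  assumes "euler_seq (\<lambda>p. b p + d p) x"
  shows "\<exists>y. euler_seq b y" "\<exists>z. euler_seq d z"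
proof -
  have le: "u \<le> u + v" "v \<le> u + v" for u v :: enat
    by (cases u; cases v; simp)+
  show "\<exists>y. euler_seq b y"
    by (rule euler_seq_le[OF assms, of b]) (auto intro: le)
  show "\<exists>z. euler_seq d z"
    by (rule euler_seq_le[OF assms, of d]) (auto intro: le)
qed

text \<open>The connecting map lowers the degree by one, which reverses all signs;
  \<open>r 0 = 0\<close> ensures that the shift loses no term.\<close>

lemma euler_seq_Suc:
  assumes "r 0 = 0"
  shows "euler_seq (\<lambda>p. r (Suc p)) (- x) \<longleftrightarrow> euler_seq r x"
proof -
  have "euler_seq r (- y)" if y: "euler_seq (\<lambda>p. r (Suc p)) y" for y
  proof -
    obtain c N where c: "\<And>p. r (Suc p) = enat (c p)"
      "\<And>M. N \<le> M \<Longrightarrow> c M = 0 \<and> y = (\<Sum>p<M. (-1) ^ p * int (c p))"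
      using y unfolding euler_seq_iff by blast
    have "r p = enat (case p of 0 \<Rightarrow> 0 | Suc q \<Rightarrow> c q)" for p
      using assms c(1) by (cases p) (auto simp: zero_enat_def)
    moreover have "(case p of 0 \<Rightarrow> 0 | Suc q \<Rightarrow> c q) = 0" if "p \<ge> Suc N" for p
      using that c(2)[of "p - 1"] by (cases p) simp_all
    moreover have "- y = (\<Sum>p<Suc N. (-1) ^ p * int (case p of 0 \<Rightarrow> 0 | Suc q \<Rightarrow> c q))"
      using c(2)[of N] by (subst sum.lessThan_Suc_shift) (auto simp: sum_negf)
    ultimately show ?thesis
      unfolding euler_seq_def by (intro exI[of _ "Suc N"] exI[of _ "\<lambda>p. case p of 0 \<Rightarrow> 0 | Suc q \<Rightarrow> c q"]) blast
  qed
  moreover have "euler_seq (\<lambda>p. r (Suc p)) (- y)" if y: "euler_seq r y" for y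
  proof -
    obtain c N where c: "\<And>p. r p = enat (c p)"
      "\<And>M. N \<le> M \<Longrightarrow> c M = 0 \<and> y = (\<Sum>p<M. (-1) ^ p * int (c p))"
      using y unfolding euler_seq_iff by blast
    have "c 0 = 0"
      using c(1)[of 0] assms by (simp add: zero_enat_def)
    have "y = (\<Sum>p<Suc N. (-1) ^ p * int (c p))"
      using c(2)[of "Suc N"] by simp
    then have "- y = (\<Sum>p<N. (-1) ^ p * int (c (Suc p)))"
      using \<open>c 0 = 0\<close> by (subst (asm) sum.lessThan_Suc_shift) (auto simp: sum_negf)
    moreover have "c (Suc p) = 0" if "N \<le> p" for p
      using c(2)[of "Suc p"] that by simp
    ultimately show ?thesis
      unfolding euler_seq_def using c(1)
      by (intro exI[of _ N] exI[of _ "\<lambda>p. c (Suc p)"]) simp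
  qed
  ultimately show ?thesis
    by (metis minus_minus)
qed

section \<open>Betti numbers and the long exact sequence of a pair\<close>

definition betti :: "'a topology \<Rightarrow> 'a set \<Rightarrow> nat \<Rightarrow> enat"
  where "betti X S p = erank (relative_homology_group (int p) X S) (carrier (relative_homology_group (int p) X S))"

text \<open>This includes finiteness of the total rank, which the bare number does not record.\<close>

definition has_rel_euler :: "'a topology \<Rightarrow> 'a set \<Rightarrow> int \<Rightarrow> bool"
  where "has_rel_euler X S e \<longleftrightarrow> euler_seq (betti X S) e"

abbreviation has_euler :: "'a topology \<Rightarrow> int \<Rightarrow> bool"
  where "has_euler X e \<equiv> has_rel_euler X {} e"

lemma has_euler_imp_euler_characteristic:
  assumes "has_euler X e"
  shows "euler_characteristic X = e"
proof -
  obtain c N where c: "\<And>p. betti X {} p = enat (c p)"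
      "\<And>M. N \<le> M \<Longrightarrow> c M = 0 \<and> e = (\<Sum>p<M. (-1) ^ p * int (c p))"
    using assms unfolding has_rel_euler_def euler_seq_iff by blast
  have rank: "abelian_rank (homology_group (int p) X) = c p" for p
    using c(1) by (intro abelian_rank_eq) (auto simp: betti_def)
  have "euler_characteristic X = (\<Sum>p | c p \<noteq> 0. (-1) ^ p * int (c p))"
    by (simp add: euler_characteristic_def rank)
  also have "\<dots> = (\<Sum>p<N. (-1) ^ p * int (c p))"
  proof (rule sum.mono_neutral_left)
    show "{p. c p \<noteq> 0} \<subseteq> {..<N}"
      using c(2) by (metis (mono_tags, lifting) lessThan_iff linorder_not_less mem_Collect_eq subsetI)
  qed auto
  finally show ?thesis
    using c(2)[of N] by simp
qed

text \<open>The sequences \<open>i\<close>, \<open>j\<close>, \<open>r\<close> are the ranks of the images of the three maps in the long exact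
  sequence of the pair; \<open>r 0 = 0\<close> because homology vanishes in degree \<open>-1\<close>.\<close>

definition long_exact_ranks ::
    "'a topology \<Rightarrow> 'a set \<Rightarrow> (nat \<Rightarrow> enat) \<Rightarrow> (nat \<Rightarrow> enat) \<Rightarrow> (nat \<Rightarrow> enat) \<Rightarrow> bool"
  where "long_exact_ranks X S i j r \<longleftrightarrow> r 0 = 0 \<and>
    betti (subtopology X S) {} = (\<lambda>p. r (Suc p) + i p) \<and>
    betti X {} = (\<lambda>p. i p + j p) \<and> betti X S = (\<lambda>p. j p + r p)"

text \<open>Exactness identifies the kernel of each map with the image of the preceding one, so
  rank-nullity splits each Betti number into two ranks of images.\<close>

lemma ex_long_exact_ranks: "\<exists>i j r. long_exact_ranks X S i j r"
proof -
  define HS HX HR where "HS p = homology_group p (subtopology X S)"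
    and "HX p = homology_group p X" and "HR p = relative_homology_group p X S" for p
  define h k d where "h p = hom_induced p (subtopology X S) {} X {} id"
    and "k p = hom_induced p X {} X S id" and "d p = hom_boundary p X S" for p
  have comm: "comm_group (HS p)" "comm_group (HX p)" "comm_group (HR p)" for p
    by (simp_all add: HS_def HX_def HR_def)
  have hom: "h p \<in> hom (HS p) (HX p)" "k p \<in> hom (HX p) (HR p)" "d p \<in> hom (HR p) (HS (p - 1))" for p
    by (simp_all add: HS_def HX_def HR_def h_def k_def d_def hom_induced_hom hom_boundary_hom)
  have ker: "kernel (HR p) (HS (p - 1)) (d p) = k p ` carrier (HX p)"
      "kernel (HS (p - 1)) (HX (p - 1)) (h (p - 1)) = d p ` carrier (HR p)"
      "kernel (HX p) (HR p) (k p) = h p ` carrier (HS p)" for p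
    using homology_exactness_axiom_1[of p X S] homology_exactness_axiom_2[of p X S]
      homology_exactness_axiom_3[of p X S]
    by (auto simp: HS_def HX_def HR_def h_def k_def d_def)
  let ?r = "\<lambda>p. erank (HS (int p - 1)) (d (int p) ` carrier (HR (int p)))"
  let ?i = "\<lambda>p. erank (HX (int p)) (h (int p) ` carrier (HS (int p)))"
  let ?j = "\<lambda>p. erank (HR (int p)) (k (int p) ` carrier (HX (int p)))"
  have "carrier (HS (- 1)) = {\<one>\<^bsub>HS (- 1)\<^esub>}"
    using trivial_homology_group[of "-1"] by (simp add: HS_def trivial_group_def)
  then have "d 0 ` carrier (HR 0) \<subseteq> {\<one>\<^bsub>HS (- 1)\<^esub>}"
    using hom(3)[of 0] by (auto simp: hom_def)
  then have r0: "?r 0 = 0"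
    using erank_trivial[OF comm(1)] by simp
  have sub: "betti (subtopology X S) {} = (\<lambda>p. ?r (Suc p) + ?i p)"
  proof
    fix p
    show "betti (subtopology X S) {} p = ?r (Suc p) + ?i p"
      using erank_hom[OF comm(1) comm(2) hom(1)[of "int p"]] ker(2)[of "int (Suc p)"]
      by (simp add: betti_def HS_def)
  qed
  have tot: "betti X {} = (\<lambda>p. ?i p + ?j p)"
  proof
    fix p
    show "betti X {} p = ?i p + ?j p"
      using erank_hom[OF comm(2) comm(3) hom(2)[of "int p"]] ker(3)[of "int p"]
      by (simp add: betti_def HX_def)
  qed
  have rel: "betti X S = (\<lambda>p. ?j p + ?r p)"
  proof
    fix p
    show "betti X S p = ?j p + ?r p"
      using erank_hom[OF comm(3) comm(1) hom(3)[of "int p"]] ker(1)[of "int p"]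
      by (simp add: betti_def HR_def)
  qed
  have "long_exact_ranks X S ?i ?j ?r"
    unfolding long_exact_ranks_def by (intro conjI r0 sub tot rel)
  then show ?thesis
    by blast
qed

lemma has_rel_euler_unique:
  assumes "has_rel_euler X S x" "has_rel_euler X S y"
  shows "x = y"
  using assms euler_seq_unique[of "betti X S" x y] by (simp only: has_rel_euler_def)

text \<open>Two of the three numbers determine the third. Any two of the three Betti sequences
  together involve all of \<open>i\<close>, \<open>j\<close> and \<open>r\<close>, so all three have
  finite alternating sums, and the missing number is read off from these.\<close>

lemma
  shows has_rel_euler_pair: "\<lbrakk>has_euler (subtopology X S) x; has_euler X y\<rbrakk> \<Longrightarrow> has_rel_euler X S (y - x)"
    and has_euler_total: "\<lbrakk>has_euler (subtopology X S) x; has_rel_euler X S z\<rbrakk> \<Longrightarrow> has_euler X (x + z)"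
    and has_euler_sub: "\<lbrakk>has_euler X y; has_rel_euler X S z\<rbrakk> \<Longrightarrow> has_euler (subtopology X S) (y - z)"
proof -
  obtain i j r where ijr: "long_exact_ranks X S i j r"
    using ex_long_exact_ranks by blast
  have r0: "r 0 = 0" and S: "betti (subtopology X S) {} = (\<lambda>p. r (Suc p) + i p)"
    and X: "betti X {} = (\<lambda>p. i p + j p)" and XS: "betti X S = (\<lambda>p. j p + r p)"
    using ijr by (simp_all add: long_exact_ranks_def)
  \<comment> \<open>In the subspace \<open>r\<close> occurs one degree lower, hence as
    \<open>- R\<close>; so the numbers of the subspace and of the pair add up to that of
    \<open>X\<close>.\<close>
  have *: "has_euler (subtopology X S) (I - R) \<and> has_euler X (I + J) \<and> has_rel_euler X S (J + R)"
    if "euler_seq i I" "euler_seq j J" "euler_seq r R" for I J R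
    using euler_seq_add[OF that(1,2)] euler_seq_add[OF that(2,3)]
      euler_seq_add[of "\<lambda>p. r (Suc p)" "- R" i I] that euler_seq_Suc[of r, OF r0, of R]
    by (simp add: has_rel_euler_def S X XS)
  { assume a: "has_euler (subtopology X S) x" and b: "has_euler X y"
    obtain I J R' where "euler_seq i I" "euler_seq j J" "euler_seq (\<lambda>p. r (Suc p)) R'"
      using a[unfolded has_rel_euler_def S, THEN euler_seq_add_parts(1)]
        a[unfolded has_rel_euler_def S, THEN euler_seq_add_parts(2)]
        b[unfolded has_rel_euler_def X, THEN euler_seq_add_parts(1)]
        b[unfolded has_rel_euler_def X, THEN euler_seq_add_parts(2)] by blast
    then have "has_euler (subtopology X S) (I + R') \<and> has_euler X (I + J) \<and> has_rel_euler X S (J - R')"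
      using *[of I J "- R'"] euler_seq_Suc[of r, OF r0, of "- R'"] by simp
    then show "has_rel_euler X S (y - x)"
      using has_rel_euler_unique[OF a, of "I + R'"] has_rel_euler_unique[OF b, of "I + J"] by simp }
  { assume a: "has_euler (subtopology X S) x" and b: "has_rel_euler X S z"
    obtain I J R' where "euler_seq i I" "euler_seq j J" "euler_seq r R'"
      using a[unfolded has_rel_euler_def S, THEN euler_seq_add_parts(1)]
        a[unfolded has_rel_euler_def S, THEN euler_seq_add_parts(2)]
        b[unfolded has_rel_euler_def XS, THEN euler_seq_add_parts(1)]
        b[unfolded has_rel_euler_def XS, THEN euler_seq_add_parts(2)] by blast
    then have "has_euler (subtopology X S) (I - R') \<and> has_euler X (I + J) \<and> has_rel_euler X S (J + R')"
      using * by simp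
    then show "has_euler X (x + z)"
      using has_rel_euler_unique[OF a, of "I - R'"] has_rel_euler_unique[OF b, of "J + R'"]
      by (simp add: add.commute) }
  { assume a: "has_euler X y" and b: "has_rel_euler X S z"
    obtain I J R' where "euler_seq i I" "euler_seq j J" "euler_seq r R'"
      using a[unfolded has_rel_euler_def X, THEN euler_seq_add_parts(1)]
        a[unfolded has_rel_euler_def X, THEN euler_seq_add_parts(2)]
        b[unfolded has_rel_euler_def XS, THEN euler_seq_add_parts(1)]
        b[unfolded has_rel_euler_def XS, THEN euler_seq_add_parts(2)] by blast
    then have "has_euler (subtopology X S) (I - R') \<and> has_euler X (I + J) \<and> has_rel_euler X S (J + R')"
      using * by simp
    then show "has_euler (subtopology X S) (y - z)"
      using has_rel_euler_unique[OF a, of "I + J"] has_rel_euler_unique[OF b, of "J + R'"]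
      by simp }
qed

lemma has_rel_euler_iso:
  assumes "\<And>p. relative_homology_group p X S \<cong> relative_homology_group p Y T" "has_rel_euler X S e"
  shows "has_rel_euler Y T e"
proof -
  have "betti X S = betti Y T"
    unfolding betti_def fun_eq_iff using assms(1) by (intro allI erank_iso) auto
  then show ?thesis
    using assms(2) by (simp add: has_rel_euler_def)
qed

lemma has_euler_homotopy_equivalent:
  assumes "X homotopy_equivalent_space Y" "has_euler X e"
  shows "has_euler Y e"
  by (rule has_rel_euler_iso[OF homotopy_equivalent_space_imp_isomorphic_homology_groups[OF assms(1)] assms(2)])

lemma has_euler_homeomorphic:
  assumes "X homeomorphic_space Y" "has_euler X e"
  shows "has_euler Y e"
  by (rule has_euler_homotopy_equivalent[OF homeomorphic_imp_homotopy_equivalent_space[OF assms(1)] assms(2)])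

lemma euler_seq_zero: "euler_seq (\<lambda>_. 0) 0"
  unfolding euler_seq_def zero_enat_def by (rule exI[of _ 0], rule exI[of _ "\<lambda>_. 0"]) simp

lemma has_euler_empty:
  assumes "topspace X = {}"
  shows "has_euler X 0"
proof -
  have "betti X {} p = 0" for p
    using trivial_relative_homology_group_empty[OF assms, of "int p" "{}"]
    unfolding betti_def by (intro erank_trivial) (auto simp: trivial_group_def)
  then have "betti X {} = (\<lambda>_. 0)"
    by blast
  then show ?thesis
    by (simp add: has_rel_euler_def euler_seq_zero)
qed

lemma has_euler_singleton:
  assumes "topspace X = {a}"
  shows "has_euler X 1"
proof -
  have "betti X {} p = (if p = 0 then 1 else 0)" for p
  proof (cases "p = 0")
    case True
    have "erank (homology_group 0 X) (carrier (homology_group 0 X)) = erank integer_group (carrier integer_group)"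
      using homology_coefficients[OF assms] abelian_integer_group by (intro erank_iso) auto
    then show ?thesis
      using True by (simp add: betti_def erank_integer_group)
  next
    case False
    then have "trivial_group (homology_group (int p) X)"
      using homology_dimension_axiom[OF assms] by simp
    then show ?thesis
      using False unfolding betti_def by (auto simp: trivial_group_def intro!: erank_trivial)
  qed
  then have "betti X {} = (\<lambda>p. if p = 0 then 1 else 0)"
    by blast
  then show ?thesis
    unfolding has_rel_euler_def euler_seq_def
    by (intro exI[of _ 1] exI[of _ "\<lambda>p. if p = 0 then 1 else 0"]) (auto simp: one_enat_def zero_enat_def)
qed

lemma has_euler_contractible:
  assumes "contractible_space X" "topspace X \<noteq> {}"
  shows "has_euler X 1"
proof -
  obtain a where a: "a \<in> topspace X" "X homotopy_equivalent_space subtopology X {a}"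
    using contractible_eq_homotopy_equivalent_singleton_subtopology[of X] assms by auto
  have "subtopology X {a} homotopy_equivalent_space X"
    using a(2) homotopy_equivalent_space_sym by blast
  moreover have "has_euler (subtopology X {a}) 1"
    using a(1) by (intro has_euler_singleton[of _ a]) simp
  ultimately show ?thesis
    by (rule has_euler_homotopy_equivalent)
qed

section \<open>Excision and additivity for open covers\<close>

lemma excision_iso:
  assumes "openin X U" "openin X V" "U \<union> V = topspace X"
  shows "relative_homology_group p (subtopology X V) (U \<inter> V) \<cong> relative_homology_group p X U"
proof -
  have V: "V \<subseteq> topspace X" and U: "U \<subseteq> topspace X"
    using assms openin_subset by auto
  \<comment> \<open>The excised set is the complement of \<open>V\<close>: it is closed and lies in
    the open set \<open>U\<close>.\<close>
  have "closedin X (topspace X - V)"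
    using assms by blast
  then have "X closure_of (topspace X - V) \<subseteq> X interior_of U"
    using assms by (auto simp: closure_of_closedin interior_of_openin)
  from homology_excision_axiom[OF this U, of p]
  have "relative_homology_group p (subtopology X (topspace X - (topspace X - V))) (U - (topspace X - V))
      \<cong> relative_homology_group p (subtopology X (topspace X)) U"
    by (auto simp: is_iso_def)
  moreover have "topspace X - (topspace X - V) = V" "U - (topspace X - V) = U \<inter> V"
    using U V by auto
  ultimately show ?thesis
    by simp
qed

text \<open>By excision the pair of \<open>X\<close> and \<open>U\<close> has the number of the pair
  of \<open>V\<close> and \<open>U \<inter> V\<close>, and the exact sequence then yields
  \<open>X\<close>.\<close>

lemma has_euler_union:
  assumes "openin X U" "openin X V" "U \<union> V = topspace X"
    and "has_euler (subtopology X U) u" "has_euler (subtopology X V) v"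
    and "has_euler (subtopology X (U \<inter> V)) w"
  shows "has_euler X (u + v - w)"
proof -
  have sub: "subtopology (subtopology X V) (U \<inter> V) = subtopology X (U \<inter> V)"
    by (simp add: subtopology_subtopology Int_absorb1 inf_commute inf_left_commute)
  have "has_rel_euler (subtopology X V) (U \<inter> V) (v - w)"
    using assms by (intro has_rel_euler_pair) (auto simp: sub)
  then have "has_rel_euler X U (v - w)"
    by (rule has_rel_euler_iso[OF excision_iso[OF assms(1-3)]])
  from has_euler_total[OF assms(4) this] show ?thesis
    by (simp add: algebra_simps)
qed

text \<open>The same computation solved for \<open>U\<close>. Finiteness for \<open>U\<close> is a
  conclusion here, as it must be when \<open>U\<close> is a hyperplane complement of unknown
  homology.\<close>

lemma has_euler_part:
  assumes "openin X U" "openin X V" "U \<union> V = topspace X"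
    and "has_euler X x" "has_euler (subtopology X V) v"
    and "has_euler (subtopology X (U \<inter> V)) w"
  shows "has_euler (subtopology X U) (x + w - v)"
proof -
  have sub: "subtopology (subtopology X V) (U \<inter> V) = subtopology X (U \<inter> V)"
    by (simp add: subtopology_subtopology Int_absorb1 inf_commute inf_left_commute)
  have "has_rel_euler (subtopology X V) (U \<inter> V) (v - w)"
    using assms by (intro has_rel_euler_pair) (auto simp: sub)
  then have "has_rel_euler X U (v - w)"
    by (rule has_rel_euler_iso[OF excision_iso[OF assms(1-3)]])
  from has_euler_sub[OF assms(4) this] show ?thesis
    by (simp add: algebra_simps)
qed

section \<open>Removing a hyperplane\<close>

definition axpy :: "complex \<Rightarrow> (nat \<Rightarrow> complex) \<Rightarrow> (nat \<Rightarrow> complex) \<Rightarrow> nat \<Rightarrow> complex"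
  where "axpy t v x = (\<lambda>i. x i + t * v i)"

text \<open>Functionals live on all sequences and are continuous for the product topology, so no
  domain has to be carried along. The identity contains additivity (\<open>t = 1\<close>) and, since
  it forces \<open>f 0 = 0\<close>, homogeneity (\<open>x = 0\<close>).\<close>

definition cfunctional :: "((nat \<Rightarrow> complex) \<Rightarrow> complex) \<Rightarrow> bool"
  where "cfunctional f \<longleftrightarrow> continuous_on UNIV f \<and>
    (\<forall>t v x. f (axpy t v x) = f x + t * f v)"

lemma axpy_0 [simp]: "axpy 0 v x = x"
  by (simp add: axpy_def)

lemma axpy_axpy [simp]: "axpy s v (axpy t v x) = axpy (s + t) v x"
  by (simp add: axpy_def fun_eq_iff algebra_simps)

lemma axpy_subspace:
  assumes "cvec.subspace V" "v \<in> V" "x \<in> V"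
  shows "axpy t v x \<in> V"
proof -
  have "axpy t v x = x + (\<lambda>i. t * v i)"
    by (simp add: axpy_def fun_eq_iff)
  then show ?thesis
    using assms cvec.subspace_add cvec.subspace_scale by metis
qed

lemma axpy_subspace_iff:
  assumes "cvec.subspace V" "v \<in> V"
  shows "axpy t v x \<in> V \<longleftrightarrow> x \<in> V"
proof
  assume "axpy t v x \<in> V"
  from axpy_subspace[OF assms this, of "- t"] show "x \<in> V" by simp
qed (rule axpy_subspace[OF assms])

lemma cfunctional_axpy: "cfunctional f \<Longrightarrow> f (axpy t v x) = f x + t * f v"
  by (simp add: cfunctional_def)

lemma cfunctional_0: "cfunctional f \<Longrightarrow> f 0 = 0"
  using cfunctional_axpy[of f "-1" 0 0] by (simp add: axpy_def zero_fun_def)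

lemma cfunctional_scale: "cfunctional f \<Longrightarrow> f (\<lambda>i. c * z i) = c * f z"
  using cfunctional_axpy[of f c z 0] cfunctional_0[of f] by (simp add: axpy_def)

lemma cfunctional_continuous: "cfunctional f \<Longrightarrow> continuous_on S g \<Longrightarrow> continuous_on S (\<lambda>x. f (g x))"
  using continuous_on_compose2[of UNIV f S g] by (simp add: cfunctional_def)

lemma continuous_on_axpy:
  assumes "continuous_on S t" "continuous_on S x"
  shows "continuous_on S (\<lambda>p. axpy (t p) v (x p))"
  unfolding axpy_def
  by (intro continuous_on_coordinatewise_then_product continuous_on_add continuous_on_mult
      continuous_on_const assms(1) continuous_on_product_then_coordinatewise[OF assms(2)])

text \<open>If \<open>g v = 1\<close>, then \<open>axpy (- g x) v x\<close> is the projection of \<open>x\<close> to the hyperplane \<open>g = 0\<close> along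
  \<open>v\<close>, so this is \<open>N\<close> thickened by the part of \<open>\<sigma>\<close> of modulus less than \<open>\<epsilon>\<close> in the direction \<open>v\<close>.\<close>

definition tube ::
    "((nat \<Rightarrow> complex) \<Rightarrow> complex) \<Rightarrow> (nat \<Rightarrow> complex) \<Rightarrow> (nat \<Rightarrow> complex) set \<Rightarrow>
     ((nat \<Rightarrow> complex) \<Rightarrow> real) \<Rightarrow> complex set \<Rightarrow> (nat \<Rightarrow> complex) set"
  where "tube g v N \<epsilon> \<sigma> =
    {x. axpy (- g x) v x \<in> N \<and> cmod (g x) < \<epsilon> (axpy (- g x) v x) \<and> g x \<in> \<sigma>}"

text \<open>The fibre \<open>\<sigma>\<close> may omit 0, as a cut plane does, so \<open>N\<close>
  need not lie in the tube; \<open>q\<close> embeds it at half the radius in the direction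
  \<open>w\<close> instead. Since \<open>\<sigma>\<close> is star-shaped about each point of the
  open ray through \<open>w\<close>, the coordinate \<open>g\<close> can be moved linearly to that
  height within the tube.\<close>

lemma tube_homotopy_equivalent:
  assumes g: "cfunctional g" "g v = 1" and N: "\<And>y. y \<in> N \<Longrightarrow> g y = 0"
    and \<epsilon>: "continuous_on N \<epsilon>" "\<And>y. y \<in> N \<Longrightarrow> 0 < \<epsilon> y"
    and w: "cmod w = 1" "\<And>a. 0 < a \<Longrightarrow> of_real a * w \<in> \<sigma>"
    and star: "\<And>t a s. \<lbrakk>t \<in> \<sigma>; 0 < a; 0 \<le> s; s \<le> 1\<rbrakk> \<Longrightarrow>
      of_real (1 - s) * t + of_real (s * a) * w \<in> \<sigma>"
  shows "top_of_set N homotopy_equivalent_space top_of_set (tube g v N \<epsilon> \<sigma>)"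
proof -
  let ?T = "tube g v N \<epsilon> \<sigma>"
  define p where "p x = axpy (- g x) v x" for x
  define q where "q y = axpy (of_real (\<epsilon> y / 2) * w) v y" for y
  define h where "h z = (case z of (s, x) \<Rightarrow>
    axpy (of_real s * (of_real (\<epsilon> (p x) / 2) * w - g x)) v x)" for z :: "real \<times> (nat \<Rightarrow> complex)"
  have gaxpy: "g (axpy t v x) = g x + t" for t x
    by (simp add: cfunctional_axpy g)
  have T: "x \<in> ?T \<longleftrightarrow> p x \<in> N \<and> cmod (g x) < \<epsilon> (p x) \<and> g x \<in> \<sigma>" for x
    by (simp add: tube_def p_def)
  have p_axpy: "p (axpy t v x) = p x" for t x
    by (simp add: p_def gaxpy)
  have p_N: "p y = y" if "y \<in> N" for y
    using N[OF that] by (simp add: p_def)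
  have gp: "g (p x) = 0" for x
    by (simp add: p_def gaxpy)
  have contg: "continuous_on S (\<lambda>x. g (f x))" if "continuous_on S f" for S and f :: "'c::topological_space \<Rightarrow> _"
    using cfunctional_continuous[OF g(1) that] .
  have contp: "continuous_on S p" for S
    unfolding p_def by (intro continuous_on_axpy continuous_on_minus contg continuous_on_id)
  have cont\<epsilon>: "continuous_on ?T (\<lambda>x. \<epsilon> (p x))"
    by (rule continuous_on_compose2[OF \<epsilon>(1) contp]) (auto simp: T)
  have q_T: "q y \<in> ?T" if y: "y \<in> N" for y
    using y \<epsilon>(2)[OF y] w(2)[of "\<epsilon> y / 2"] w(1) N[OF y]
    by (simp add: T q_def p_axpy p_N gaxpy norm_mult)
  have h_T: "h (s, x) \<in> ?T" if s: "0 \<le> s" "s \<le> 1" and x: "x \<in> ?T" for s x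
  proof -
    have px: "p x \<in> N" "cmod (g x) < \<epsilon> (p x)" "g x \<in> \<sigma>" and pos: "0 < \<epsilon> (p x)"
      using x T \<epsilon>(2) by auto
    have gh: "g (h (s, x)) = of_real (1 - s) * g x + of_real (s * (\<epsilon> (p x) / 2)) * w"
      by (simp add: h_def gaxpy algebra_simps)
    have "cmod (g (h (s, x))) \<le> (1 - s) * cmod (g x) + s * (\<epsilon> (p x) / 2)"
    proof -
      have "cmod (g (h (s, x))) \<le> cmod (of_real (1 - s) * g x) + cmod (of_real (s * (\<epsilon> (p x) / 2)) * w)"
        unfolding gh by (rule norm_triangle_ineq)
      also have "\<dots> = (1 - s) * cmod (g x) + s * (\<epsilon> (p x) / 2)"
        using s pos w(1) by (simp only: norm_mult norm_of_real) simp
      finally show ?thesis .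
    qed
    \<comment> \<open>Strictness comes from the given point if \<open>s = 0\<close> and from the
      embedded copy of \<open>N\<close> otherwise.\<close>
    also have "\<dots> < \<epsilon> (p x)"
    proof (cases "s = 0")
      case True
      then show ?thesis using px by simp
    next
      case False
      have "(1 - s) * cmod (g x) \<le> (1 - s) * \<epsilon> (p x)"
        using s px by (intro mult_left_mono) auto
      moreover have "s * (\<epsilon> (p x) / 2) < s * \<epsilon> (p x)"
        using s False pos by (intro mult_strict_left_mono) auto
      ultimately show ?thesis
        by (simp add: algebra_simps)
    qed
    finally show ?thesis
      using star[OF px(3), of "\<epsilon> (p x) / 2" s] s pos px(1)
      unfolding T gh by (simp add: h_def p_axpy)
  qed
  have cont_q: "continuous_map (top_of_set N) (top_of_set ?T) q"
  proof -
    have "continuous_on N q"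
      unfolding q_def by (intro continuous_on_axpy continuous_on_mult continuous_on_of_real
          continuous_on_divide continuous_on_id continuous_on_const \<epsilon>(1)) auto
    then show ?thesis
      using q_T by (auto simp: continuous_map_in_subtopology)
  qed
  have cont_p: "continuous_map (top_of_set ?T) (top_of_set N) p"
    using contp by (auto simp: continuous_map_in_subtopology T)
  have h_cont: "continuous_on ({0..1} \<times> ?T) h"
  proof -
    have "continuous_on ({0..1} \<times> ?T) (\<lambda>z. \<epsilon> (p (snd z)))"
      by (rule continuous_on_compose2[OF cont\<epsilon>]) (auto intro: continuous_intros)
    then have "continuous_on ({0..1} \<times> ?T) (\<lambda>z. axpy (of_real (fst z) * (of_real (\<epsilon> (p (snd z)) / 2) * w - g (snd z))) v (snd z))"
      by (intro continuous_on_axpy continuous_intros contg) auto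
    then show ?thesis
      by (simp add: h_def case_prod_unfold)
  qed
  have "homotopic_with (\<lambda>_. True) (top_of_set ?T) (top_of_set ?T) id (q \<circ> p)"
    unfolding homotopic_with_def
  proof (intro exI[of _ h] conjI allI ballI TrueI)
    show "continuous_map (prod_topology (top_of_set {0..1}) (top_of_set ?T)) (top_of_set ?T) h"
      using h_cont h_T by (auto simp: continuous_map_in_subtopology)
    show "h (0, x) = id x" for x
      by (simp add: h_def)
    show "h (1, x) = (q \<circ> p) x" for x
      by (simp add: h_def q_def p_def)
  qed
  then have "homotopic_with (\<lambda>_. True) (top_of_set ?T) (top_of_set ?T) (q \<circ> p) id"
    by (simp add: homotopic_with_sym)
  moreover have "homotopic_with (\<lambda>_. True) (top_of_set N) (top_of_set N) (p \<circ> q) id"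
  proof (rule homotopic_with_equal)
    show "continuous_map (top_of_set N) (top_of_set N) (p \<circ> q)"
      using cont_q cont_p continuous_map_compose by blast
    show "(p \<circ> q) x = id x" if "x \<in> topspace (top_of_set N)" for x
      using that by (simp add: q_def p_axpy p_N)
  qed auto
  ultimately show ?thesis
    unfolding homotopy_equivalent_space_def using cont_p cont_q by blast
qed

lemma has_euler_union_on:
  assumes "openin (top_of_set M) U" "openin (top_of_set M) V" "U \<union> V = M"
    and "has_euler (top_of_set U) u" "has_euler (top_of_set V) v"
    and "has_euler (top_of_set (U \<inter> V)) w"
  shows "has_euler (top_of_set M) (u + v - w)"
proof -
  have "subtopology (top_of_set M) U = top_of_set U" "subtopology (top_of_set M) V = top_of_set V"
      "subtopology (top_of_set M) (U \<inter> V) = top_of_set (U \<inter> V)"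
    using assms(3) by (auto simp: subtopology_subtopology Int_absorb1 intro!: arg_cong[where f = top_of_set])
  then show ?thesis
    using has_euler_union[OF assms(1,2), of u v w] assms by simp
qed

lemma has_euler_part_on:
  assumes "openin (top_of_set M) U" "openin (top_of_set M) V" "U \<union> V = M"
    and "has_euler (top_of_set M) x" "has_euler (top_of_set V) v"
    and "has_euler (top_of_set (U \<inter> V)) w"
  shows "has_euler (top_of_set U) (x + w - v)"
proof -
  have "subtopology (top_of_set M) U = top_of_set U" "subtopology (top_of_set M) V = top_of_set V"
      "subtopology (top_of_set M) (U \<inter> V) = top_of_set (U \<inter> V)"
    using assms(3) by (auto simp: subtopology_subtopology Int_absorb1 intro!: arg_cong[where f = top_of_set])
  then show ?thesis
    using has_euler_part[OF assms(1,2), of x v w] assms by simp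
qed

text \<open>Additivity is used backwards: \<open>M\<close> is covered by the complement, which is
  the unknown, and the tube, which counts \<open>k\<close>; they overlap in the punctured tube,
  which counts 0.\<close>

lemma has_euler_delete_hyperplane:
  assumes g: "cfunctional g" "g v = 1"
    and N: "N = {x \<in> M. g x = 0}"
    and \<epsilon>: "continuous_on N \<epsilon>" "\<And>y. y \<in> N \<Longrightarrow> 0 < \<epsilon> y"
    and opn: "openin (top_of_set M) (tube g v N \<epsilon> UNIV)"
    and M: "has_euler (top_of_set M) m" and k: "has_euler (top_of_set N) k"
  shows "has_euler (top_of_set {x \<in> M. g x \<noteq> 0}) (m - k)"
proof -
  let ?T = "tube g v N \<epsilon>"
  have gN: "g y = 0" if "y \<in> N" for y
    using that N by auto
  have contg: "continuous_on S g" for S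
    using cfunctional_continuous[OF g(1), of S "\<lambda>x. x"] by simp
  have tube_open: "openin (top_of_set (?T \<tau>)) (?T \<sigma>)" if "open \<sigma>" "\<sigma> \<subseteq> \<tau>" for \<sigma> \<tau>
  proof -
    have "?T \<sigma> = ?T \<tau> \<inter> g -` \<sigma>"
      using that(2) by (auto simp: tube_def)
    then show ?thesis
      using continuous_openin_preimage_gen[OF contg that(1)] by simp
  qed
  note equiv = tube_homotopy_equivalent[OF g gN \<epsilon>]
  have full: "has_euler (top_of_set (?T UNIV)) k"
    by (rule has_euler_homotopy_equivalent[OF equiv[of 1] k]) auto
  define half where "half e = {t. 0 < e * Im t}" for e
  have half: "has_euler (top_of_set (?T (half e))) k" if e: "e = 1 \<or> e = - 1" for e
  proof (rule has_euler_homotopy_equivalent[OF equiv[of "\<i> * of_real e"] k])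
    have ee: "e * e = 1"
      using e by auto
    show "cmod (\<i> * of_real e) = 1"
      using e by auto
    show "of_real a * (\<i> * of_real e) \<in> half e" if "0 < a" for a
      using e that by (auto simp: half_def)
    show "of_real (1 - s) * t + of_real (s * a) * (\<i> * of_real e) \<in> half e"
      if t: "t \<in> half e" and as: "0 < a" "0 \<le> s" "s \<le> 1" for t a s
    proof -
      have "0 < (1 - s) * (e * Im t) + s * a"
      proof (cases "s = 0")
        case True
        then show ?thesis using t by (simp add: half_def)
      next
        case False
        then have "0 < s * a" "0 \<le> (1 - s) * (e * Im t)"
          using t as by (auto simp: half_def)
        then show ?thesis by linarith
      qed
      also have "\<dots> = (1 - s) * (e * Im t) + s * a * (e * e)"
        by (simp only: ee mult_1_right)
      also have "\<dots> = e * Im (of_real (1 - s) * t + of_real (s * a) * (\<i> * of_real e))"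
        by (simp add: algebra_simps)
      finally show ?thesis by (simp add: half_def)
    qed
  qed
  \<comment> \<open>For \<open>w = 1\<close> and \<open>w = - 1\<close> this is the plane cut along
    the closed real ray opposite to \<open>w\<close>. The two cut planes cover the punctured plane
    and meet in the two open half planes.\<close>
  define slit where "slit w = {t. Im t \<noteq> 0 \<or> 0 < Re (t * w)}" for w
  have slit: "has_euler (top_of_set (?T (slit (of_real e)))) k" if "e = 1 \<or> e = - 1" for e
  proof (rule has_euler_homotopy_equivalent[OF equiv[of "of_real e"] k])
    show "cmod (of_real e) = 1"
      using that by auto
    show "of_real a * of_real e \<in> slit (of_real e)" if "0 < a" for a
      using \<open>e = 1 \<or> e = - 1\<close> that by (auto simp: slit_def)
    show "of_real (1 - s) * t + of_real (s * a) * of_real e \<in> slit (of_real e)"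
      if t: "t \<in> slit (of_real e)" and as: "0 < a" "0 \<le> s" "s \<le> 1" for t a s
    \<comment> \<open>For \<open>Im t \<noteq> 0\<close> and \<open>s \<noteq> 1\<close> the
      imaginary part stays nonzero; otherwise the point is real and its sign has to be
      checked.\<close>
    proof (cases "Im t = 0 \<or> s = 1")
      case False
      then show ?thesis by (auto simp: slit_def)
    next
      case True
      have "0 < (1 - s) * (Re t * e) + s * a"
      proof (cases "s = 1")
        case True
        then show ?thesis using as by simp
      next
        case False
        then have "0 < Re t * e"
          using t True by (auto simp: slit_def)
        then have "0 < (1 - s) * (Re t * e)" "0 \<le> s * a"
          using as False by auto
        then show ?thesis by linarith
      qed
      moreover have "e * e = 1"
        using \<open>e = 1 \<or> e = - 1\<close> by auto
      moreover have "((1 - s) * Re t + s * a * e) * e = (1 - s) * (Re t * e) + s * a * (e * e)"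
        by (simp add: algebra_simps)
      ultimately have "0 < ((1 - s) * Re t + s * a * e) * e"
        by (simp only: mult_1_right)
      then show ?thesis
        by (simp add: slit_def)
    qed
  qed
  have open_slit: "open (slit w)" for w
    unfolding slit_def by (intro open_Collect_disj open_Collect_neq open_Collect_less continuous_intros)
  have open_half: "open (half e)" for e
    unfolding half_def by (intro open_Collect_less continuous_intros)
  have T_Un: "?T \<sigma> \<union> ?T \<tau> = ?T (\<sigma> \<union> \<tau>)" and T_Int: "?T \<sigma> \<inter> ?T \<tau> = ?T (\<sigma> \<inter> \<tau>)" for \<sigma> \<tau>
    by (auto simp: tube_def)
  have two: "has_euler (top_of_set (?T {t. Im t \<noteq> 0})) (k + k - 0)"
  proof (rule has_euler_union_on)
    have eq: "half 1 \<union> half (- 1) = {t. Im t \<noteq> 0}"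
      by (auto simp: half_def)
    show "?T (half 1) \<union> ?T (half (- 1)) = ?T {t. Im t \<noteq> 0}"
      unfolding T_Un eq ..
    show "openin (top_of_set (?T {t. Im t \<noteq> 0})) (?T (half 1))"
         "openin (top_of_set (?T {t. Im t \<noteq> 0})) (?T (half (- 1)))"
      by (rule tube_open[OF open_half]; auto simp: half_def)+
    show "has_euler (top_of_set (?T (half 1))) k" "has_euler (top_of_set (?T (half (- 1)))) k"
      by (rule half; simp)+
    have "?T (half 1) \<inter> ?T (half (- 1)) = {}"
      unfolding T_Int by (auto simp: tube_def half_def)
    then show "has_euler (top_of_set (?T (half 1) \<inter> ?T (half (- 1)))) 0"
      by (simp add: has_euler_empty)
  qed
  \<comment> \<open>Each cut plane contributes \<open>k\<close>, and so does each of the two half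
    planes in their intersection.\<close>
  have "has_euler (top_of_set (?T (- {0}))) (k + k - (k + k - 0))"
  proof (rule has_euler_union_on)
    have eq: "slit (of_real 1) \<union> slit (of_real (- 1)) = - {0}" "slit (of_real 1) \<inter> slit (of_real (- 1)) = {t. Im t \<noteq> 0}"
      by (auto simp: slit_def complex_eq_iff)
    show "?T (slit (of_real 1)) \<union> ?T (slit (of_real (- 1))) = ?T (- {0})"
      unfolding T_Un eq ..
    show "openin (top_of_set (?T (- {0}))) (?T (slit (of_real 1)))"
         "openin (top_of_set (?T (- {0}))) (?T (slit (of_real (- 1))))"
      using eq(1) by (intro tube_open open_slit; blast)+
    show "has_euler (top_of_set (?T (slit (of_real 1)))) k" "has_euler (top_of_set (?T (slit (of_real (- 1))))) k"
      by (rule slit; simp)+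
    show "has_euler (top_of_set (?T (slit (of_real 1)) \<inter> ?T (slit (of_real (- 1))))) (k + k - 0)"
      unfolding T_Int eq by (rule two)
  qed
  then have punctured: "has_euler (top_of_set (?T (- {0}))) 0"
    by simp
  have "has_euler (top_of_set {x \<in> M. g x \<noteq> 0}) (m + 0 - k)"
  proof (rule has_euler_part_on[OF _ opn _ M full])
    have "{x \<in> M. g x \<noteq> 0} = M \<inter> g -` (- {0})"
      by auto
    then show "openin (top_of_set M) {x \<in> M. g x \<noteq> 0}"
      using continuous_openin_preimage_gen[OF contg, of "- {0}" M] by (simp add: open_Compl)
    have TM: "?T UNIV \<subseteq> M"
      using openin_imp_subset[OF opn] .
    have "N \<subseteq> ?T UNIV"
      using \<epsilon>(2) gN by (auto simp: tube_def)
    then show "{x \<in> M. g x \<noteq> 0} \<union> ?T UNIV = M"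
      using TM N by auto
    have "{x \<in> M. g x \<noteq> 0} \<inter> ?T UNIV = ?T (- {0})"
      using TM by (auto simp: tube_def)
    then show "has_euler (top_of_set ({x \<in> M. g x \<noteq> 0} \<inter> ?T UNIV)) 0"
      using punctured by simp
  qed
  then show ?thesis by simp
qed

section \<open>Affine arrangements\<close>

definition unit_vec :: "nat \<Rightarrow> nat \<Rightarrow> complex"
  where "unit_vec i = (\<lambda>k. if k = i then 1 else 0)"

lemma fun_sum_apply: "(\<Sum>i\<in>A. h i) k = (\<Sum>i\<in>A. h i k)"
  for h :: "'i \<Rightarrow> nat \<Rightarrow> complex"
  by (induction A rule: infinite_finite_induct) auto

lemma cspace_expand:
  assumes "z \<in> cspace N"
  shows "z = (\<Sum>i<N. (\<lambda>k. z i * unit_vec i k))"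
proof
  fix k
  have "(\<Sum>i<N. z i * unit_vec i k) = (\<Sum>i<N. if i = k then z k else 0)"
    by (intro sum.cong) (auto simp: unit_vec_def)
  also have "\<dots> = z k"
    using assms by (simp add: cspace_def)
  finally show "z k = (\<Sum>i<N. (\<lambda>k. z i * unit_vec i k)) k"
    by (simp add: fun_sum_apply)
qed

lemma cspace_subset_span: "cspace N \<subseteq> cvec.span (unit_vec ` {..<N})"
proof
  fix z assume "z \<in> cspace N"
  then have "z = (\<Sum>i<N. (\<lambda>k. z i * unit_vec i k))"
    by (rule cspace_expand)
  also have "\<dots> \<in> cvec.span (unit_vec ` {..<N})"
    by (intro cvec.span_sum cvec.span_scale cvec.span_base) auto
  finally show "z \<in> cvec.span (unit_vec ` {..<N})" .
qed

text \<open>The space of all sequences has infinite dimension, so finiteness of bases has to come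
  from the unit vectors spanning \<open>cspace N\<close>.\<close>

lemma independent_cspace:
  assumes "cvec.independent B" "B \<subseteq> cspace N"
  shows "finite B" "card B \<le> N"
proof -
  have "finite B \<and> card B \<le> card (unit_vec ` {..<N})"
    using assms cspace_subset_span[of N] by (intro cvec.independent_span_bound) auto
  then show "finite B" "card B \<le> N"
    using card_image_le[of "{..<N}" unit_vec] by auto
qed

lemma subspace_kernel:
  assumes "cvec.subspace V" "cfunctional f"
  shows "cvec.subspace {z \<in> V. f z = 0}"
proof (rule cvec.subspaceI)
  show "0 \<in> {z \<in> V. f z = 0}"
    using assms cvec.subspace_0 cfunctional_0 by auto
  show "x + y \<in> {z \<in> V. f z = 0}" if "x \<in> {z \<in> V. f z = 0}" "y \<in> {z \<in> V. f z = 0}" for x y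
  proof -
    have "x + y = axpy 1 y x"
      by (simp add: axpy_def fun_eq_iff)
    then show ?thesis
      using that assms by (auto simp: cfunctional_axpy axpy_subspace)
  qed
  show "(\<lambda>i. c * x i) \<in> {z \<in> V. f z = 0}" if "x \<in> {z \<in> V. f z = 0}" for c x
    using that assms cvec.subspace_scale[of V x c] by (auto simp: cfunctional_scale)
qed

lemma dim_zero_space: "cvec.dim {0 :: nat \<Rightarrow> complex} = 0"
  using cvec.dim_eq_card[of "{}" "{0}"] cvec.independent_empty by simp

text \<open>A basis of the kernel together with \<open>v\<close> is a basis of \<open>V\<close>,
  since subtracting \<open>f z / f v\<close> times \<open>v\<close> moves \<open>z\<close> into the
  kernel.\<close>

lemma dim_kernel:
  assumes V: "cvec.subspace V" "V \<subseteq> cspace N" and f: "cfunctional f" and v: "v \<in> V" "f v \<noteq> 0"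
  shows "cvec.dim V = cvec.dim {z \<in> V. f z = 0} + 1"
proof -
  let ?K = "{z \<in> V. f z = 0}"
  obtain B where B: "B \<subseteq> ?K" "cvec.independent B" "?K \<subseteq> cvec.span B" "card B = cvec.dim ?K"
    using cvec.basis_exists[of ?K] by blast
  have "cvec.span B \<subseteq> ?K"
    using B(1) subspace_kernel[OF V(1) f] by (rule cvec.span_minimal)
  then have v_span: "v \<notin> cvec.span B"
    using v by auto
  have ind: "cvec.independent (insert v B)"
    using cvec.independent_insertI[OF v_span B(2)] .
  have "V \<subseteq> cvec.span (insert v B)"
  proof
    fix z assume z: "z \<in> V"
    define k where "k = f z / f v"
    have "axpy (- k) v z \<in> ?K"
      using z v V f by (simp add: axpy_subspace cfunctional_axpy k_def)
    moreover have "axpy (- k) v z = z - (\<lambda>i. k * v i)"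
      by (simp add: axpy_def fun_eq_iff)
    ultimately have "z - (\<lambda>i. k * v i) \<in> cvec.span B"
      using B(3) by auto
    then show "z \<in> cvec.span (insert v B)"
      by (auto simp: cvec.span_breakdown_eq)
  qed
  moreover have "insert v B \<subseteq> V"
    using v B(1) by auto
  ultimately have "cvec.dim V = card (insert v B)"
    using ind cvec.dim_unique by metis
  moreover have "finite B"
    using independent_cspace(1)[OF B(2), of N] B(1) V(2) by blast
  moreover have "v \<notin> B"
    using v_span cvec.span_base by blast
  ultimately show ?thesis
    using B(4) by simp
qed

text \<open>By Whitney's formula this is, for finite \<open>J\<close>, the derivative at 1 of the
  characteristic polynomial of the arrangement cut out in \<open>V\<close>. Repeated functionals are
  allowed and do not change it; a functional vanishing on \<open>V\<close> makes it 0.\<close>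

definition alt_dim :: "(nat \<Rightarrow> complex) set \<Rightarrow> ('i \<Rightarrow> (nat \<Rightarrow> complex) \<Rightarrow> complex) \<Rightarrow> 'i set \<Rightarrow> int"
  where "alt_dim V \<phi> J = (\<Sum>C\<in>Pow J. (-1) ^ card C * int (cvec.dim {z \<in> V. \<forall>j\<in>C. \<phi> j z = 0}))"

text \<open>Deletion and restriction: the subsets are split according to whether they contain
  \<open>j\<close>.\<close>

lemma alt_dim_insert_fresh:
  assumes "finite J" "j \<notin> J"
  shows "alt_dim V \<phi> (insert j J) = alt_dim V \<phi> J - alt_dim {z \<in> V. \<phi> j z = 0} \<phi> J"
proof -
  let ?F = "\<lambda>C. (-1) ^ card C * int (cvec.dim {z \<in> V. \<forall>j\<in>C. \<phi> j z = 0})"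
  have "inj_on (insert j) (Pow J)"
    using assms(2) by (auto simp: inj_on_def)
  moreover have "?F (insert j C) =
      - ((-1) ^ card C * int (cvec.dim {z \<in> {z \<in> V. \<phi> j z = 0}. \<forall>j\<in>C. \<phi> j z = 0}))"
    if "C \<in> Pow J" for C
  proof -
    have "finite C" "j \<notin> C"
      using that assms finite_subset by auto
    moreover have "{z \<in> V. \<forall>i\<in>insert j C. \<phi> i z = 0} = {z \<in> {z \<in> V. \<phi> j z = 0}. \<forall>i\<in>C. \<phi> i z = 0}"
      by auto
    ultimately show ?thesis
      by simp
  qed
  ultimately have "sum ?F (insert j ` Pow J) = - alt_dim {z \<in> V. \<phi> j z = 0} \<phi> J"
    unfolding alt_dim_def sum_negf[symmetric] by (subst sum.reindex) (auto intro!: sum.cong)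
  moreover have "alt_dim V \<phi> (insert j J) = sum ?F (Pow J) + sum ?F (insert j ` Pow J)"
    unfolding alt_dim_def Pow_insert using assms by (intro sum.union_disjoint) auto
  ultimately show ?thesis
    by (simp add: alt_dim_def)
qed

lemma alt_dim_eq_0:
  assumes "finite J" "j \<in> J" "\<And>z. z \<in> V \<Longrightarrow> \<phi> j z = 0"
  shows "alt_dim V \<phi> J = 0"
proof -
  have "{z \<in> V. \<phi> j z = 0} = V"
    using assms(3) by auto
  then show ?thesis
    using alt_dim_insert_fresh[of "J - {j}" j V \<phi>] assms by (simp add: insert_absorb)
qed

text \<open>For \<open>j \<in> J\<close> the subtracted term is 0 by \<open>alt_dim_eq_0\<close>.
  This generality is needed in \<open>has_euler_proj_union\<close>, where \<open>j\<close> is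
  inserted into an arbitrary \<open>K\<close>.\<close>

lemma alt_dim_insert:
  assumes "finite J"
  shows "alt_dim V \<phi> (insert j J) = alt_dim V \<phi> J - alt_dim {z \<in> V. \<phi> j z = 0} \<phi> J"
proof (cases "j \<in> J")
  case True
  then show ?thesis
    using alt_dim_eq_0[OF assms True, of "{z \<in> V. \<phi> j z = 0}"] by (simp add: insert_absorb)
qed (rule alt_dim_insert_fresh[OF assms])

lemma alt_dim_empty [simp]: "alt_dim V \<phi> {} = int (cvec.dim V)"
  by (simp add: alt_dim_def)

text \<open>The slice \<open>f = 1\<close> is the affine chart of the projective space of
  \<open>V\<close> whose hyperplane at infinity is \<open>f = 0\<close>.\<close>

definition affine_part ::
    "(nat \<Rightarrow> complex) set \<Rightarrow> ((nat \<Rightarrow> complex) \<Rightarrow> complex) \<Rightarrow>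
     ('i \<Rightarrow> (nat \<Rightarrow> complex) \<Rightarrow> complex) \<Rightarrow> 'i set \<Rightarrow> (nat \<Rightarrow> complex) set"
  where "affine_part V f \<phi> J = {z \<in> V. f z = 1 \<and> (\<forall>j\<in>J. \<phi> j z \<noteq> 0)}"

lemma has_euler_affine_space:
  assumes V: "cvec.subspace V" and f: "cfunctional f" and z0: "z0 \<in> V" "f z0 = 1"
  shows "has_euler (top_of_set {z \<in> V. f z = 1}) 1"
proof -
  let ?S = "{z \<in> V. f z = 1}"
  define h where "h p = (\<lambda>i. snd p i + of_real (fst p) * (z0 i - snd p i))"
    for p :: "real \<times> (nat \<Rightarrow> complex)"
  have "h (s, x) \<in> ?S" if x: "x \<in> ?S" for s x
  proof -
    have "h (s, x) = axpy (of_real s) (axpy (- 1) x z0) x"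
      by (simp add: h_def axpy_def fun_eq_iff algebra_simps)
    then show ?thesis
      using x z0 by (simp add: axpy_subspace[OF V] cfunctional_axpy[OF f])
  qed
  moreover have "continuous_on ({0..1} \<times> ?S) h"
    unfolding h_def
    by (intro continuous_on_coordinatewise_then_product continuous_on_add continuous_on_mult
        continuous_on_of_real continuous_on_diff continuous_on_const continuous_on_fst continuous_on_id
        continuous_on_product_then_coordinatewise[OF continuous_on_snd])
  ultimately have "homotopic_with (\<lambda>_. True) (top_of_set ?S) (top_of_set ?S) id (\<lambda>_. z0)"
    unfolding homotopic_with_def
    by (intro exI[of _ h]) (auto simp: continuous_map_in_subtopology h_def)
  then have "contractible_space (top_of_set ?S)"
    unfolding contractible_space_def by blast
  then show ?thesis
    using z0 by (intro has_euler_contractible) auto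
qed

text \<open>Shifting \<open>y\<close> by \<open>t\<close> along \<open>v\<close> changes
  \<open>\<phi> i y\<close> by \<open>t * \<phi> i v\<close>, so it meets no removed hyperplane as
  long as \<open>cmod t * cmod (\<phi> i v) < cmod (\<phi> i y)\<close>. The radius
  \<open>\<epsilon>\<close> ensures this for all \<open>i\<close> at once and depends continuously
  on \<open>y\<close>; the summand 1 keeps the denominator positive. The condition
  \<open>f v = 0\<close> keeps the shift inside the slice.\<close>

lemma affine_part_tube_open:
  assumes V: "cvec.subspace V" and f: "cfunctional f" and \<phi>: "\<And>j. j \<in> J \<Longrightarrow> cfunctional (\<phi> j)"
    and J: "finite J"
    and g: "cfunctional g" "g v = 1" and v: "v \<in> V" "f v = 0"
    and \<epsilon>: "\<epsilon> = (\<lambda>y. inverse (1 + (\<Sum>i\<in>J. cmod (\<phi> i v) / cmod (\<phi> i y))))"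
    and N: "N = {x \<in> affine_part V f \<phi> J. g x = 0}"
  shows "continuous_on N \<epsilon>" "\<And>y. 0 < \<epsilon> y"
    "openin (top_of_set (affine_part V f \<phi> J)) (tube g v N \<epsilon> UNIV)"
proof -
  define O' where "O' = {x. \<forall>i\<in>J. \<phi> i x \<noteq> 0}"
  define p where "p x = axpy (- g x) v x" for x
  have \<phi>_cont: "continuous_on S (\<phi> i)" if "i \<in> J" for i S
    using cfunctional_continuous[OF \<phi>[OF that], of S "\<lambda>x. x"] by simp
  have g_cont: "continuous_on S g" for S
    using cfunctional_continuous[OF g(1), of S "\<lambda>x. x"] by simp
  have sum_nonneg: "0 \<le> (\<Sum>i\<in>J. cmod (\<phi> i v) / cmod (\<phi> i y))" for y
    by (intro sum_nonneg) auto
  show pos: "0 < \<epsilon> y" for y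
    using sum_nonneg[of y] by (simp add: \<epsilon> add_pos_nonneg)
  have \<epsilon>_cont: "continuous_on O' \<epsilon>"
    unfolding \<epsilon>
  proof (intro continuous_on_inverse continuous_on_add continuous_on_const continuous_on_sum
      continuous_on_divide continuous_on_norm \<phi>_cont ballI)
    show "1 + (\<Sum>i\<in>J. cmod (\<phi> i v) / cmod (\<phi> i y)) \<noteq> 0" for y
      using sum_nonneg[of y] by linarith
  qed (auto simp: O'_def)
  then show "continuous_on N \<epsilon>"
    by (rule continuous_on_subset) (auto simp: N affine_part_def O'_def)
  have p_cont: "continuous_on S p" for S
    unfolding p_def by (intro continuous_on_axpy continuous_on_minus g_cont continuous_on_id)
  have "O' = (\<Inter>i\<in>J. \<phi> i -` (- {0}))"
    by (auto simp: O'_def)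
  moreover have "open (\<phi> i -` (- {0}))" if "i \<in> J" for i
    using continuous_open_vimage[of "- {0}" "\<phi> i"] \<phi>_cont[OF that, of UNIV]
    by (simp add: continuous_on_eq_continuous_at open_Compl)
  ultimately have "open O'"
    using J by (auto intro: open_INT)
  then have open_p: "open (p -` O')"
    using p_cont[of UNIV] by (intro open_vimage) auto
  \<comment> \<open>Continuity of \<open>\<epsilon>\<close> is known on \<open>O'\<close>, so
    openness is shown inside the open preimage of \<open>O'\<close> under \<open>p\<close>.\<close>
  have "open {x \<in> p -` O'. cmod (g x) < \<epsilon> (p x)}"
  proof -
    have "continuous_on (p -` O') (\<lambda>x. \<epsilon> (p x) - cmod (g x))"
      by (intro continuous_on_diff continuous_on_norm g_cont
          continuous_on_compose2[OF \<epsilon>_cont p_cont]) auto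
    then have "open ((\<lambda>x. \<epsilon> (p x) - cmod (g x)) -` {0<..} \<inter> p -` O')"
      using open_p continuous_on_open_vimage[OF open_p] open_greaterThan by blast
    moreover have "(\<lambda>x. \<epsilon> (p x) - cmod (g x)) -` {0<..} \<inter> p -` O' = {x \<in> p -` O'. cmod (g x) < \<epsilon> (p x)}"
      by auto
    ultimately show ?thesis by simp
  qed
  moreover have "tube g v N \<epsilon> UNIV = affine_part V f \<phi> J \<inter> {x \<in> p -` O'. cmod (g x) < \<epsilon> (p x)}"
  proof -
    \<comment> \<open>If \<open>\<phi> i x\<close> were 0, then
      \<open>cmod (\<phi> i v) / cmod (\<phi> i (p x))\<close> times \<open>cmod (g x)\<close> would
      be exactly 1, whereas the radius makes it less than 1.\<close>
    have nz: "\<phi> i x \<noteq> 0" if i: "i \<in> J" and x: "p x \<in> O'" "cmod (g x) < \<epsilon> (p x)" for i x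
    proof
      assume zero: "\<phi> i x = 0"
      let ?y = "p x"
      have \<phi>y: "\<phi> i ?y \<noteq> 0"
        using i x by (auto simp: O'_def)
      have "\<phi> i ?y = - g x * \<phi> i v"
        using zero by (simp add: p_def cfunctional_axpy[OF \<phi>[OF i]])
      then have eq: "cmod (\<phi> i ?y) = cmod (g x) * cmod (\<phi> i v)"
        by (simp add: norm_mult)
      have "1 = cmod (\<phi> i ?y) / cmod (\<phi> i ?y)"
        using \<phi>y by simp
      also have "\<dots> = cmod (g x) * (cmod (\<phi> i v) / cmod (\<phi> i ?y))"
        by (subst eq) (rule times_divide_eq_right[symmetric])
      also have "\<dots> \<le> cmod (g x) * (\<Sum>i\<in>J. cmod (\<phi> i v) / cmod (\<phi> i ?y))"
        using i J by (intro mult_left_mono member_le_sum) auto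
      also have "\<dots> \<le> cmod (g x) * (1 + (\<Sum>i\<in>J. cmod (\<phi> i v) / cmod (\<phi> i ?y)))"
        by (intro mult_left_mono) auto
      also have "\<dots> < \<epsilon> ?y * (1 + (\<Sum>i\<in>J. cmod (\<phi> i v) / cmod (\<phi> i ?y)))"
        using x sum_nonneg[of ?y] by (intro mult_strict_right_mono) auto
      also have "\<dots> = 1"
        using sum_nonneg[of ?y] unfolding \<epsilon> by (intro left_inverse) linarith
      finally show False by simp
    qed
    have "p x \<in> N \<longleftrightarrow> x \<in> V \<and> f x = 1 \<and> p x \<in> O'" for x
      using axpy_subspace_iff[OF V v(1), of "- g x" x] v(2) g
      by (auto simp: N affine_part_def O'_def p_def cfunctional_axpy f)
    then show ?thesis
      using nz by (auto simp: tube_def p_def[symmetric] affine_part_def)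
  qed
  ultimately show "openin (top_of_set (affine_part V f \<phi> J)) (tube g v N \<epsilon> UNIV)"
    by (auto intro: openin_open_Int)
qed

text \<open>Both sides obey deletion and restriction in \<open>j\<close>. On the geometric side this
  needs a direction inside the slice along which \<open>\<phi> j\<close> varies; without one,
  \<open>\<phi> j\<close> is constant on the slice and the step is checked directly.\<close>

lemma has_euler_affine_part:
  assumes J: "finite J" and \<phi>: "\<And>j. j \<in> J \<Longrightarrow> cfunctional (\<phi> j)" and f: "cfunctional f"
    and V: "cvec.subspace V" "V \<subseteq> cspace N"
  shows "has_euler (top_of_set (affine_part V f \<phi> J)) (alt_dim V \<phi> J - alt_dim {z \<in> V. f z = 0} \<phi> J)"
  using J \<phi> V
proof (induction J arbitrary: V rule: finite_induct)
  case empty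
  have part: "affine_part V f \<phi> {} = {z \<in> V. f z = 1}"
    by (auto simp: affine_part_def)
  show ?case
  proof (cases "\<exists>v\<in>V. f v \<noteq> 0")
    case True
    then obtain v where v: "v \<in> V" "f v \<noteq> 0"
      by blast
    have "(\<lambda>i. inverse (f v) * v i) \<in> V" "f (\<lambda>i. inverse (f v) * v i) = 1"
      using v empty(2) f by (auto intro!: cvec.subspace_scale simp: cfunctional_scale)
    then show ?thesis
      using has_euler_affine_space[OF empty(2) f] dim_kernel[OF empty(2,3) f v]
      by (simp add: part)
  next
    case False
    then have "{z \<in> V. f z = 0} = V" "{z \<in> V. f z = 1} = {}"
      by auto
    then show ?thesis
      by (simp add: part has_euler_empty)
  qed
next
  case (insert j J)
  let ?Vj = "{z \<in> V. \<phi> j z = 0}" and ?Vf = "{z \<in> V. f z = 0}"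
  let ?Vjf = "{z \<in> ?Vj. f z = 0}"
  let ?M = "affine_part V f \<phi> J" and ?N = "affine_part ?Vj f \<phi> J"
  have \<phi>j: "cfunctional (\<phi> j)" and \<phi>J: "\<And>i. i \<in> J \<Longrightarrow> cfunctional (\<phi> i)"
    using insert.prems(1) by auto
  have V: "cvec.subspace V" "V \<subseteq> cspace N"
    using insert.prems by auto
  have M: "has_euler (top_of_set ?M) (alt_dim V \<phi> J - alt_dim ?Vf \<phi> J)"
    using insert.IH[OF \<phi>J V] .
  have N: "has_euler (top_of_set ?N) (alt_dim ?Vj \<phi> J - alt_dim ?Vjf \<phi> J)"
    using V(2) by (intro insert.IH[OF \<phi>J subspace_kernel[OF V(1) \<phi>j]]) auto
  have "{z \<in> ?Vf. \<phi> j z = 0} = ?Vjf"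
    by auto
  then have val: "alt_dim V \<phi> (insert j J) - alt_dim ?Vf \<phi> (insert j J) =
      (alt_dim V \<phi> J - alt_dim ?Vf \<phi> J) - (alt_dim ?Vj \<phi> J - alt_dim ?Vjf \<phi> J)"
    using insert.hyps(1) by (simp add: alt_dim_insert)
  have part: "affine_part V f \<phi> (insert j J) = {x \<in> ?M. \<phi> j x \<noteq> 0}"
    by (auto simp: affine_part_def)
  show ?case
  proof (cases "\<exists>v\<in>V. f v = 0 \<and> \<phi> j v \<noteq> 0")
    case True
    then obtain u where u: "u \<in> V" "f u = 0" "\<phi> j u \<noteq> 0"
      by blast
    define v where "v = (\<lambda>i. inverse (\<phi> j u) * u i)"
    have v: "v \<in> V" "f v = 0" "\<phi> j v = 1"
      using u V(1) f \<phi>j unfolding v_def by (auto intro!: cvec.subspace_scale simp: cfunctional_scale)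
    have NM: "?N = {x \<in> ?M. \<phi> j x = 0}"
      by (auto simp: affine_part_def)
    note tube = affine_part_tube_open[OF V(1) f \<phi>J insert.hyps(1) \<phi>j v(3,1,2) refl NM]
    show ?thesis
      unfolding val part
      by (rule has_euler_delete_hyperplane[OF \<phi>j v(3) NM tube(1) tube(2) tube(3) M N])
  next
    \<comment> \<open>Here \<open>\<phi> j\<close> vanishes wherever \<open>f\<close> does on
      \<open>V\<close>, so on \<open>V\<close> it is a multiple of \<open>f\<close> unless
      \<open>f\<close> is zero there.\<close>
    case False
    then have deg: "\<And>z. z \<in> V \<Longrightarrow> f z = 0 \<Longrightarrow> \<phi> j z = 0"
      by blast
    show ?thesis
    proof (cases "\<exists>z\<in>V. f z = 1")
      case no: False
      have f0: "f z = 0" if "z \<in> V" for z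
      proof (rule ccontr)
        assume "f z \<noteq> 0"
        then have "(\<lambda>i. inverse (f z) * z i) \<in> V" "f (\<lambda>i. inverse (f z) * z i) = 1"
          using that V(1) f by (auto intro!: cvec.subspace_scale simp: cfunctional_scale)
        then show False using no by blast
      qed
      then have "?Vf = V" "affine_part V f \<phi> (insert j J) = {}"
        by (auto simp: affine_part_def)
      then show ?thesis
        by (simp add: has_euler_empty)
    next
      case True
      then obtain z0 where z0: "z0 \<in> V" "f z0 = 1"
        by blast
      have lin: "\<phi> j z = f z * \<phi> j z0" if "z \<in> V" for z
        using deg[of "axpy (- f z) z0 z"] that z0 V(1) f \<phi>j
        by (simp add: axpy_subspace cfunctional_axpy)
      show ?thesis
      proof (cases "\<phi> j z0 = 0")
        case True
        then have "?Vj = V" "affine_part V f \<phi> (insert j J) = {}"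
          using lin by (auto simp: affine_part_def)
        then show ?thesis
          unfolding val by (simp add: has_euler_empty)
      next
        \<comment> \<open>The hyperplane misses the slice: nothing is removed, and the restricted
          sums cancel because \<open>f\<close> vanishes on \<open>?Vj\<close>.\<close>
        case nz: False
        then have "?Vjf = ?Vj" "affine_part V f \<phi> (insert j J) = ?M"
          using lin by (auto simp: affine_part_def)
        then show ?thesis
          using M unfolding val by simp
      qed
    qed
  qed
qed

section \<open>Projective arrangements\<close>

lemma cline_eq: "cline z = range (\<lambda>c i. c * z i)"
  by (simp add: cline_def cvec.span_singleton)

lemma cline_subset_iff:
  assumes "cvec.subspace V"
  shows "cline z \<subseteq> V \<longleftrightarrow> z \<in> V"
proof
  show "z \<in> V" if "cline z \<subseteq> V"
    using that cvec.span_base[of z "{z}"] by (auto simp: cline_def)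
  show "cline z \<subseteq> V" if "z \<in> V"
    using that assms by (simp add: cline_def cvec.span_minimal)
qed

lemma cline_nonzero_iff:
  assumes "cfunctional f"
  shows "(\<exists>y\<in>cline z. f y \<noteq> 0) \<longleftrightarrow> f z \<noteq> 0"
proof
  show "\<exists>y\<in>cline z. f y \<noteq> 0" if "f z \<noteq> 0"
    using that cvec.span_base[of z "{z}"] by (auto simp: cline_def)
  show "f z \<noteq> 0" if "\<exists>y\<in>cline z. f y \<noteq> 0"
    using that assms by (auto simp: cline_eq cfunctional_scale)
qed

section \<open>Affine charts of projective space\<close>

definition nonvanishing :: "nat \<Rightarrow> ((nat \<Rightarrow> complex) \<Rightarrow> complex) \<Rightarrow> (nat \<Rightarrow> complex) set set"
  where "nonvanishing n f = {L \<in> cproj n. \<exists>z\<in>L. f z \<noteq> 0}"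

lemma cline_nonvanishing:
  assumes "cfunctional f" "z \<in> cspace (Suc n) - {0}"
  shows "cline z \<in> nonvanishing n f \<longleftrightarrow> f z \<noteq> 0"
  using assms cline_in_cproj[OF assms(2)] by (simp add: nonvanishing_def cline_nonzero_iff)

lemma openin_nonvanishing:
  assumes "cfunctional f"
  shows "openin (CP n) (nonvanishing n f)"
proof -
  have "cproj_cone n (nonvanishing n f) = (cspace (Suc n) - {0}) \<inter> f -` (- {0})"
    using cline_nonvanishing[OF assms] by (auto simp: cproj_cone_def)
  moreover have "continuous_on (cspace (Suc n) - {0}) f"
    using cfunctional_continuous[OF assms, of _ "\<lambda>x. x"] by simp
  ultimately have "openin (top_of_set (cspace (Suc n) - {0})) (cproj_cone n (nonvanishing n f))"
    using continuous_openin_preimage_gen[of "cspace (Suc n) - {0}" f "- {0}"] by (simp add: open_Compl)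
  then show ?thesis
    by (auto simp: openin_CP nonvanishing_def)
qed

text \<open>On lines where \<open>f\<close> is not identically zero this normalizes the homogeneous
  coordinates by \<open>f = 1\<close>; it will be the inverse of \<open>cline\<close> on the
  slice.\<close>

definition chart :: "((nat \<Rightarrow> complex) \<Rightarrow> complex) \<Rightarrow> (nat \<Rightarrow> complex) set \<Rightarrow> nat \<Rightarrow> complex"
  where "chart f L = (THE z. z \<in> L \<and> f z = 1)"

lemma chart_cline:
  assumes "cfunctional f" "f z \<noteq> 0"
  shows "chart f (cline z) = (\<lambda>i. inverse (f z) * z i)"
  unfolding chart_def
proof (rule the_equality)
  show "(\<lambda>i. inverse (f z) * z i) \<in> cline z \<and> f (\<lambda>i. inverse (f z) * z i) = 1"
    using assms by (auto simp: cline_eq cfunctional_scale)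
  show "y = (\<lambda>i. inverse (f z) * z i)" if y: "y \<in> cline z \<and> f y = 1" for y
  proof -
    obtain c where c: "y = (\<lambda>i. c * z i)"
      using y by (auto simp: cline_eq)
    then have "c * f z = 1"
      using y cfunctional_scale[OF assms(1)] by simp
    then have "c = inverse (f z)"
      by (metis inverse_unique mult.commute)
    then show ?thesis
      using c by simp
  qed
qed

text \<open>\<open>cline\<close> remains a quotient map over an open set, so continuity can be
  tested on the cone, where the chart is division by \<open>f z\<close>.\<close>

lemma continuous_map_chart:
  assumes "cfunctional f"
  shows "continuous_map (subtopology (CP n) (nonvanishing n f)) euclidean (chart f)"
proof -
  let ?C = "cspace (Suc n) - {0}"
  let ?Z = "{z \<in> ?C. f z \<noteq> 0}"
  have "{z \<in> topspace (top_of_set ?C). cline z \<in> nonvanishing n f} = ?Z"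
    using cline_nonvanishing[OF assms] by auto
  then have "quotient_map (subtopology (top_of_set ?C) ?Z) (subtopology (CP n) (nonvanishing n f)) cline"
    using quotient_map_restriction[OF quotient_map_cline] openin_nonvanishing[OF assms] by blast
  moreover have "subtopology (top_of_set ?C) ?Z = top_of_set ?Z"
    by (auto simp: subtopology_subtopology intro!: arg_cong[where f = top_of_set])
  ultimately have quot: "quotient_map (top_of_set ?Z) (subtopology (CP n) (nonvanishing n f)) cline"
    by simp
  have "continuous_on ?Z (\<lambda>z i. inverse (f z) * z i)"
    using cfunctional_continuous[OF assms, of ?Z "\<lambda>x. x"]
    by (intro continuous_on_coordinatewise_then_product continuous_on_mult continuous_on_inverse
        continuous_on_product_then_coordinatewise[OF continuous_on_id]) auto
  then have "continuous_map (top_of_set ?Z) euclidean (chart f \<circ> cline)"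
    by (subst continuous_map_iff_continuous, subst continuous_on_cong[OF refl])
       (auto simp: chart_cline[OF assms])
  then show ?thesis
    using continuous_compose_quotient_map_eq[OF quot] by blast
qed

definition proj_part ::
    "nat \<Rightarrow> (nat \<Rightarrow> complex) set \<Rightarrow> ('i \<Rightarrow> (nat \<Rightarrow> complex) \<Rightarrow> complex) \<Rightarrow> 'i set \<Rightarrow>
     (nat \<Rightarrow> complex) set set"
  where "proj_part n V \<phi> K = {L \<in> cproj n. L \<subseteq> V \<and> (\<forall>k\<in>K. \<exists>z\<in>L. \<phi> k z \<noteq> 0)}"

lemma cline_in_proj_part:
  assumes "cvec.subspace V" "\<And>k. k \<in> K \<Longrightarrow> cfunctional (\<phi> k)" "z \<in> cspace (Suc n) - {0}"
  shows "cline z \<in> proj_part n V \<phi> K \<longleftrightarrow> z \<in> V \<and> (\<forall>k\<in>K. \<phi> k z \<noteq> 0)"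
  using assms cline_in_cproj[OF assms(3)]
  by (simp add: proj_part_def cline_subset_iff cline_nonzero_iff)

text \<open>A line on which \<open>\<phi> k\<close> is nonzero meets the slice
  \<open>\<phi> k = 1\<close> in exactly one point, so \<open>cline\<close> and \<open>chart\<close>
  are inverse to each other.\<close>

lemma proj_part_homeomorphic_affine_part:
  assumes V: "cvec.subspace V" "V \<subseteq> cspace (Suc n)"
    and \<phi>: "\<And>j. j \<in> insert k K \<Longrightarrow> cfunctional (\<phi> j)"
  shows "top_of_set (affine_part V (\<phi> k) \<phi> K) homeomorphic_space
    subtopology (CP n) (proj_part n V \<phi> (insert k K))"
proof -
  let ?A = "affine_part V (\<phi> k) \<phi> K" and ?P = "proj_part n V \<phi> (insert k K)"
  have f: "cfunctional (\<phi> k)"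
    using \<phi> by blast
  have P_sub: "?P \<subseteq> cproj n" "?P \<subseteq> nonvanishing n (\<phi> k)"
    by (auto simp: proj_part_def nonvanishing_def)
  have A_sub: "?A \<subseteq> cspace (Suc n) - {0}"
    using V(2) cfunctional_0[OF f] by (auto simp: affine_part_def)
  have cline_iff: "cline z \<in> ?P \<longleftrightarrow> z \<in> V \<and> (\<forall>j\<in>insert k K. \<phi> j z \<noteq> 0)"
    if "z \<in> cspace (Suc n) - {0}" for z
    using V(1) \<phi> that by (rule cline_in_proj_part)
  have cline_P: "cline z \<in> ?P" if "z \<in> ?A" for z
    proof -
    have "z \<in> cspace (Suc n) - {0}"
      using that A_sub by blast
    then show ?thesis
      using that cline_iff by (auto simp: affine_part_def)
  qed
  have "continuous_map (top_of_set ?A) (CP n) cline"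
    using continuous_map_from_subtopology_mono[OF quotient_imp_continuous_map[OF quotient_map_cline] A_sub] .
  then have 1: "continuous_map (top_of_set ?A) (subtopology (CP n) ?P) cline"
    using cline_P by (auto simp: continuous_map_in_subtopology)
  have chart: "chart (\<phi> k) L \<in> ?A \<and> cline (chart (\<phi> k) L) = L" if L: "L \<in> ?P" for L
  proof -
    obtain z where z: "z \<in> cspace (Suc n) - {0}" "L = cline z"
      using L P_sub cproj_eq_image_cline by blast
    have zV: "z \<in> V" "\<And>j. j \<in> insert k K \<Longrightarrow> \<phi> j z \<noteq> 0"
      using L cline_iff[OF z(1)] unfolding z(2) by auto
    let ?c = "inverse (\<phi> k z)"
    have c: "?c \<noteq> 0" "\<phi> k z \<noteq> 0"
      using zV(2) by auto
    have eq: "chart (\<phi> k) (cline z) = (\<lambda>i. ?c * z i)"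
      by (rule chart_cline[OF f c(2)])
    have "(\<lambda>i. ?c * z i) \<in> ?A"
      using zV c \<phi> V(1) by (auto simp: affine_part_def cfunctional_scale intro!: cvec.subspace_scale)
    moreover have "cline (\<lambda>i. ?c * z i) = cline z"
    proof
      show "cline (\<lambda>i. ?c * z i) \<subseteq> cline z"
        unfolding cline_def by (intro cvec.span_minimal cvec.subspace_span) (auto intro: cvec.span_scale cvec.span_base)
      have "z = (\<lambda>i. \<phi> k z * (?c * z i))"
        using c by (simp add: fun_eq_iff)
      then have "z \<in> cvec.span {\<lambda>i. ?c * z i}"
        using cvec.span_scale[OF cvec.span_base, of "\<lambda>i. ?c * z i" "{\<lambda>i. ?c * z i}" "\<phi> k z"] by simp
      then show "cline z \<subseteq> cline (\<lambda>i. ?c * z i)"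
        unfolding cline_def by (intro cvec.span_minimal cvec.subspace_span) auto
    qed
    ultimately show ?thesis
      unfolding z(2) eq by blast
  qed
  have "continuous_map (subtopology (CP n) ?P) euclidean (chart (\<phi> k))"
    using continuous_map_from_subtopology_mono[OF continuous_map_chart[OF f] P_sub(2)] .
  then have 2: "continuous_map (subtopology (CP n) ?P) (top_of_set ?A) (chart (\<phi> k))"
    using chart by (auto simp: continuous_map_in_subtopology)
  have "chart (\<phi> k) (cline z) = z" if "z \<in> ?A" for z
    using that chart_cline[OF f, of z] by (auto simp: affine_part_def)
  then have "homeomorphic_maps (top_of_set ?A) (subtopology (CP n) ?P) cline (chart (\<phi> k))"
    unfolding homeomorphic_maps_def using 1 2 chart by auto
  then show ?thesis
    by (rule homeomorphic_maps_imp_homeomorphic_space)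
qed

text \<open>With \<open>\<phi> k = 0\<close> placed at infinity, the value from
  \<open>has_euler_affine_part\<close> is the right side of \<open>alt_dim_insert\<close> for
  \<open>k\<close>.\<close>

lemma has_euler_proj_part_insert:
  assumes V: "cvec.subspace V" "V \<subseteq> cspace (Suc n)" and K: "finite K"
    and \<phi>: "\<And>j. j \<in> insert k K \<Longrightarrow> cfunctional (\<phi> j)"
  shows "has_euler (subtopology (CP n) (proj_part n V \<phi> (insert k K))) (alt_dim V \<phi> (insert k K))"
  unfolding alt_dim_insert[OF K]
  using \<phi> by (intro has_euler_homeomorphic[OF proj_part_homeomorphic_affine_part[OF V \<phi>]]
      has_euler_affine_part[OF K _ _ V]) auto

section \<open>Gluing affine charts\<close>

definition proj_union ::
    "nat \<Rightarrow> (nat \<Rightarrow> complex) set \<Rightarrow> ('i \<Rightarrow> (nat \<Rightarrow> complex) \<Rightarrow> complex) \<Rightarrow> 'i set \<Rightarrow> 'i set \<Rightarrow>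
     (nat \<Rightarrow> complex) set set"
  where "proj_union n V \<phi> J K = {L \<in> proj_part n V \<phi> K. \<exists>j\<in>J. \<exists>z\<in>L. \<phi> j z \<noteq> 0}"

text \<open>The charts \<open>\<phi> j \<noteq> 0\<close> are added one at a time. The new chart
  meets the union of the old ones in a union of the same kind, with \<open>j\<close> moved into
  \<open>K\<close>; hence the induction is over all \<open>K\<close>.\<close>

lemma has_euler_proj_union:
  assumes V: "cvec.subspace V" "V \<subseteq> cspace (Suc n)"
    and J: "finite J" and K: "finite K" and \<phi>: "\<And>j. cfunctional (\<phi> j)"
  shows "has_euler (subtopology (CP n) (proj_union n V \<phi> J K))
    (alt_dim V \<phi> K - alt_dim {z \<in> V. \<forall>j\<in>J. \<phi> j z = 0} \<phi> K)"
  using J K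
proof (induction J arbitrary: K rule: finite_induct)
  case empty
  have "proj_union n V \<phi> {} K = {}"
    by (auto simp: proj_union_def)
  then show ?case
    by (simp add: has_euler_empty)
next
  case (insert j J)
  let ?Q = "proj_union n V \<phi>"
  let ?X = "subtopology (CP n) (?Q (insert j J) K)"
  let ?W = "{z \<in> V. \<forall>j\<in>J. \<phi> j z = 0}" and ?W' = "{z \<in> V. \<forall>i\<in>insert j J. \<phi> i z = 0}"
  have Q_sub: "?Q I K \<subseteq> cproj n" for I
    by (auto simp: proj_union_def proj_part_def)
  have QU: "?Q J K \<union> proj_part n V \<phi> (insert j K) = ?Q (insert j J) K"
    by (auto simp: proj_union_def proj_part_def)
  have QI: "?Q J K \<inter> proj_part n V \<phi> (insert j K) = ?Q J (insert j K)"
    by (auto simp: proj_union_def proj_part_def)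
  have sub: "subtopology ?X S = subtopology (CP n) S" if "S \<subseteq> ?Q (insert j J) K" for S
    using that by (simp add: subtopology_subtopology Int_absorb1)
  have "has_euler ?X ((alt_dim V \<phi> K - alt_dim ?W \<phi> K) + alt_dim V \<phi> (insert j K)
      - (alt_dim V \<phi> (insert j K) - alt_dim ?W \<phi> (insert j K)))"
  proof (rule has_euler_union)
    have "?Q J K = (\<Union>i\<in>J. nonvanishing n (\<phi> i)) \<inter> ?Q (insert j J) K"
      by (auto simp: proj_union_def proj_part_def nonvanishing_def)
    moreover have "openin (CP n) (\<Union>i\<in>J. nonvanishing n (\<phi> i))"
      using openin_nonvanishing[OF \<phi>] by blast
    ultimately show "openin ?X (?Q J K)"
      unfolding openin_subtopology by blast
    have "proj_part n V \<phi> (insert j K) = nonvanishing n (\<phi> j) \<inter> ?Q (insert j J) K"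
      by (auto simp: proj_union_def proj_part_def nonvanishing_def)
    then show "openin ?X (proj_part n V \<phi> (insert j K))"
      unfolding openin_subtopology using openin_nonvanishing[OF \<phi>] by blast
    show "?Q J K \<union> proj_part n V \<phi> (insert j K) = topspace ?X"
      using Q_sub QU by (auto simp: topspace_CP)
    show "has_euler (subtopology ?X (?Q J K)) (alt_dim V \<phi> K - alt_dim ?W \<phi> K)"
      using insert.IH[OF insert.prems] QU by (subst sub) auto
    show "has_euler (subtopology ?X (proj_part n V \<phi> (insert j K))) (alt_dim V \<phi> (insert j K))"
      using has_euler_proj_part_insert[OF V insert.prems \<phi>] QU by (subst sub) auto
    show "has_euler (subtopology ?X (?Q J K \<inter> proj_part n V \<phi> (insert j K)))
        (alt_dim V \<phi> (insert j K) - alt_dim ?W \<phi> (insert j K))"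
      using insert.IH[of "insert j K"] insert.prems QU QI by (subst sub) auto
  qed
  moreover have "{z \<in> ?W. \<phi> j z = 0} = ?W'"
    by auto
  then have "alt_dim ?W \<phi> (insert j K) = alt_dim ?W \<phi> K - alt_dim ?W' \<phi> K"
    using alt_dim_insert[OF insert.prems, of ?W \<phi> j] by simp
  ultimately show ?case
    by simp
qed

lemma cfunctional_coordinate: "cfunctional (\<lambda>z. z i)"
  by (simp add: cfunctional_def axpy_def)

text \<open>The coordinate functions provide the charts. They cover everything, and their common
  zero space is \<open>{0}\<close>, so the correction term of \<open>has_euler_proj_union\<close> is
  0.\<close>

lemma has_euler_proj_subspace:
  assumes V: "cvec.subspace V" "V \<subseteq> cspace (Suc n)"
  shows "has_euler (subtopology (CP n) {L \<in> cproj n. L \<subseteq> V}) (int (cvec.dim V))"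
proof -
  let ?\<phi> = "\<lambda>i z. z i"
  have "\<exists>i\<in>{..n}. \<exists>z\<in>L. z i \<noteq> 0" if L: "L \<in> cproj n" for L
  proof -
    obtain z where z: "z \<in> cspace (Suc n) - {0}" "L = cline z"
      using L cproj_eq_image_cline by blast
    have "z \<in> L"
      unfolding z(2) cline_def by (simp add: cvec.span_base)
    moreover obtain i where "z i \<noteq> 0"
      using z(1) by (auto simp: fun_eq_iff)
    moreover have "i \<le> n"
      using z(1) \<open>z i \<noteq> 0\<close> by (auto simp: cspace_def Suc_le_eq not_less[symmetric])
    ultimately show ?thesis by blast
  qed
  then have "proj_union n V ?\<phi> {..n} {} = {L \<in> cproj n. L \<subseteq> V}"
    by (auto simp: proj_union_def proj_part_def)
  moreover have "{z \<in> V. \<forall>j\<in>{..n}. z j = 0} = {0}"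
  proof -
    have "z = 0" if "z \<in> V" "\<forall>j\<in>{..n}. z j = 0" for z
    proof
      show "z i = 0 i" for i
        using that V(2) by (cases "i \<le> n") (auto simp: cspace_def)
    qed
    then show ?thesis
      using cvec.subspace_0[OF V(1)] by auto
  qed
  ultimately show ?thesis
    using has_euler_proj_union[OF V, of "{..n}" "{}" ?\<phi>] cfunctional_coordinate by (simp add: dim_zero_space)
qed

text \<open>If some hyperplane is removed, it can be placed at infinity and one chart suffices; only
  the full projective subspace needs the gluing argument.\<close>

lemma has_euler_proj_part:
  assumes V: "cvec.subspace V" "V \<subseteq> cspace (Suc n)" and K: "finite K"
    and \<phi>: "\<And>j. j \<in> K \<Longrightarrow> cfunctional (\<phi> j)"
  shows "has_euler (subtopology (CP n) (proj_part n V \<phi> K)) (alt_dim V \<phi> K)"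
proof (cases "K = {}")
  case True
  then show ?thesis
    using has_euler_proj_subspace[OF V] by (simp add: proj_part_def)
next
  case False
  then obtain k where "k \<in> K"
    by blast
  then show ?thesis
    using has_euler_proj_part_insert[OF V, of "K - {k}" k \<phi>] K \<phi> by (simp add: insert_absorb)
qed

section \<open>Strata of an arrangement in general position\<close>

lemma cfunctional_sum_coordinates: "cfunctional (\<lambda>z. \<Sum>i<N. z i * a i)"
  unfolding cfunctional_def
proof (intro conjI allI)
  show "continuous_on UNIV (\<lambda>z. \<Sum>i<N. z i * a i)"
    by (intro continuous_on_sum continuous_on_mult continuous_on_product_coordinates continuous_on_const)
  show "(\<Sum>i<N. axpy t v x i * a i) = (\<Sum>i<N. x i * a i) + t * (\<Sum>i<N. v i * a i)" for t v x
    by (simp add: axpy_def algebra_simps sum.distrib sum_distrib_left)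
qed

text \<open>A linear extension \<open>g\<close> to all sequences need not be continuous. The finite
  sum of the \<open>z i * g (unit_vec i)\<close> is continuous and agrees with it on
  \<open>cspace N\<close>.\<close>

lemma linear_functional_on_cspace:
  assumes "cvec.independent B"
  obtains f where "cfunctional f" "\<And>x. x \<in> B \<Longrightarrow> x \<in> cspace N \<Longrightarrow> f x = h x"
proof -
  interpret vp: vector_space_pair "\<lambda>(c::complex) (z::nat \<Rightarrow> complex) i. c * z i" "(*) :: complex \<Rightarrow> complex \<Rightarrow> complex"
    by (intro vector_space_pair.intro cvec.vector_space_axioms vector_space.intro)
       (simp_all add: algebra_simps)
  obtain g where g: "Vector_Spaces.linear (\<lambda>(c::complex) z i. c * z i) (*) g" "\<forall>x\<in>B. g x = h x"
    using vp.linear_independent_extend[OF assms, of h] by blast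
  interpret g: Vector_Spaces.linear "\<lambda>(c::complex) z i. c * z i" "(*)" g
    by (rule g(1))
  show thesis
  proof (rule that)
    show "cfunctional (\<lambda>z. \<Sum>i<N. z i * g (unit_vec i))"
      by (rule cfunctional_sum_coordinates)
    show "(\<Sum>i<N. x i * g (unit_vec i)) = h x" if "x \<in> B" "x \<in> cspace N" for x
    proof -
      have "h x = g (\<Sum>i<N. (\<lambda>k. x i * unit_vec i k))"
        using g(2) that(1) cspace_expand[OF that(2)] by simp
      also have "\<dots> = (\<Sum>i<N. x i * g (unit_vec i))"
        by (simp only: g.sum g.scale)
      finally show ?thesis by simp
    qed
  qed
qed

text \<open>The equation is the functional dual to a vector \<open>v\<close> outside
  \<open>W\<close>: it is 1 at \<open>v\<close> and 0 on a basis of \<open>W\<close>.\<close>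

lemma hyperplane_functional:
  assumes "linear_subspace_codim n 1 A"
  obtains f where "cfunctional f" "A = {L \<in> cproj n. \<forall>z\<in>L. f z = 0}"
proof -
  obtain W where W: "cvec.subspace W" "W \<subseteq> cspace (Suc n)" "cvec.dim W + 1 = Suc n"
      "A = {L \<in> cproj n. L \<subseteq> W}"
    using assms by (auto simp: linear_subspace_codim_def)
  obtain B where B: "B \<subseteq> W" "cvec.independent B" "W \<subseteq> cvec.span B" "card B = n"
    using cvec.basis_exists[of W] W(3) by (metis add_right_cancel Suc_eq_plus1)
  have span_B: "cvec.span B = W"
    using B cvec.span_minimal[OF B(1) W(1)] by blast
  have fin: "finite B"
    using independent_cspace[OF B(2)] B(1) W(2) by blast
  \<comment> \<open>Otherwise the \<open>n + 1\<close> independent unit vectors would lie in the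
    span of the \<open>n\<close> vectors of \<open>B\<close>.\<close>
  have "\<not> cspace (Suc n) \<subseteq> W"
  proof
    assume "cspace (Suc n) \<subseteq> W"
    have inj: "inj_on unit_vec {..<Suc n}"
      by (auto simp: inj_on_def unit_vec_def fun_eq_iff)
    have "unit_vec ` {..<Suc n} \<subseteq> cspace (Suc n)"
      by (auto simp: unit_vec_def cspace_def)
    have ind: "cvec.independent (unit_vec ` {..<Suc n})"
    proof (rule cvec.independent_if_scalars_zero)
      fix c x assume sum: "(\<Sum>y\<in>unit_vec ` {..<Suc n}. (\<lambda>i. c y * y i)) = 0"
        and "x \<in> unit_vec ` {..<Suc n}"
      then obtain k where k: "k < Suc n" "x = unit_vec k"
        by auto
      have "0 = (\<Sum>i<Suc n. (\<lambda>j. c (unit_vec i) * unit_vec i j)) k"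
        using sum by (simp add: sum.reindex[OF inj] zero_fun_def fun_eq_iff)
      also have "\<dots> = (\<Sum>i<Suc n. if i = k then c (unit_vec k) else 0)"
        unfolding fun_sum_apply by (intro sum.cong) (auto simp: unit_vec_def)
      also have "\<dots> = c x"
        using k by simp
      finally show "c x = 0" by simp
    qed simp
    have "unit_vec ` {..<Suc n} \<subseteq> cvec.span B"
      using \<open>unit_vec ` {..<Suc n} \<subseteq> cspace (Suc n)\<close> \<open>cspace (Suc n) \<subseteq> W\<close> span_B by blast
    then have "card (unit_vec ` {..<Suc n}) \<le> card B"
      using cvec.independent_span_bound[OF fin ind] by blast
    then show False
      using B(4) inj by (simp add: card_image)
  qed
  then obtain v where v: "v \<in> cspace (Suc n)" "v \<notin> W"
    by blast
  have ind: "cvec.independent (insert v B)"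
    using cvec.independent_insertI[of v B] v span_B B(2) by blast
  have vB: "v \<notin> B"
    using v B(1) by blast
  \<comment> \<open>A vector outside this span would give \<open>n + 2\<close> independent vectors
    in \<open>cspace (Suc n)\<close>.\<close>
  have spans: "cspace (Suc n) \<subseteq> cvec.span (insert v B)"
  proof
    fix z assume z: "z \<in> cspace (Suc n)"
    show "z \<in> cvec.span (insert v B)"
    proof (rule ccontr)
      assume not: "z \<notin> cvec.span (insert v B)"
      then have "cvec.independent (insert z (insert v B))"
        using cvec.independent_insertI[OF not ind] by blast
      then have "card (insert z (insert v B)) \<le> Suc n"
        using z v(1) B(1) W(2) by (intro independent_cspace) auto
      moreover have "z \<notin> insert v B"
        using not cvec.span_base by blast
      ultimately show False
        using fin vB B(4) by simp
    qed
  qed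
  obtain f where f: "cfunctional f"
      "\<And>x. x \<in> insert v B \<Longrightarrow> x \<in> cspace (Suc n) \<Longrightarrow> f x = (if x = v then 1 else 0)"
    using linear_functional_on_cspace[OF ind, of "Suc n" "\<lambda>x. if x = v then 1 else 0"] by blast
  have fv: "f v = 1"
    using f(2)[of v] v(1) by simp
  have W_ker: "W \<subseteq> {z \<in> cspace (Suc n). f z = 0}"
  proof -
    have "B \<subseteq> {z \<in> cspace (Suc n). f z = 0}"
      using f(2) B(1) W(2) vB by auto
    then have "cvec.span B \<subseteq> {z \<in> cspace (Suc n). f z = 0}"
      using subspace_kernel[OF subspace_cspace f(1)] by (rule cvec.span_minimal)
    then show ?thesis
      using span_B by simp
  qed
  have ker_W: "z \<in> W" if z: "z \<in> cspace (Suc n)" "f z = 0" for z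
  proof -
    have "z \<in> cvec.span (insert v B)"
      using spans z(1) by blast
    then obtain k where k: "z - (\<lambda>i. k * v i) \<in> W"
      unfolding cvec.span_breakdown_eq span_B by blast
    have eq: "z - (\<lambda>i. k * v i) = axpy (- k) v z"
      by (simp add: axpy_def fun_eq_iff)
    have "f (axpy (- k) v z) = 0"
      using k W_ker unfolding eq by auto
    then have "k = 0"
      using z(2) fv by (simp add: cfunctional_axpy[OF f(1)])
    then show ?thesis
      using k eq by simp
  qed
  have "A = {L \<in> cproj n. \<forall>z\<in>L. f z = 0}"
  proof -
    have "L \<subseteq> W \<longleftrightarrow> (\<forall>z\<in>L. f z = 0)" if "L \<in> cproj n" for L
    proof -
      have "L \<subseteq> cspace (Suc n)"
        using that by (simp add: cproj_def)
      then show ?thesis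
        using W_ker ker_W by blast
    qed
    then show ?thesis
      using W(4) by blast
  qed
  then show thesis
    using that f(1) by blast
qed

text \<open>Each nonzero vector spans a line, so a linear subspace is recovered from its projective
  points. This carries the codimensions of general position over to the spaces cut out by
  functionals.\<close>

lemma proj_subspace_mono:
  assumes "cvec.subspace V" "V \<subseteq> cspace (Suc n)" "cvec.subspace W"
    and "{L \<in> cproj n. L \<subseteq> V} \<subseteq> {L \<in> cproj n. L \<subseteq> W}"
  shows "V \<subseteq> W"
proof
  fix z assume z: "z \<in> V"
  show "z \<in> W"
  proof (cases "z = 0")
    case True
    then show ?thesis
      using cvec.subspace_0[OF assms(3)] by simp
  next
    case False
    then have "cline z \<in> cproj n"
      using z assms(2) by (intro cline_in_cproj) auto
    moreover have "cline z \<subseteq> V"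
      using z assms(1) by (simp add: cline_subset_iff)
    ultimately have "cline z \<subseteq> W"
      using assms(4) by blast
    then show ?thesis
      by (simp add: cline_subset_iff[OF assms(3)])
  qed
qed

section \<open>Sums over subsets\<close>

lemma sum_disjoint_pairs:
  fixes G :: "'i set \<Rightarrow> 'i set \<Rightarrow> real"
  assumes "finite I"
  shows "(\<Sum>B\<in>Pow I. \<Sum>C\<in>Pow (I - B). G B C) = (\<Sum>D\<in>Pow I. \<Sum>B\<in>Pow D. G B (D - B))"
proof -
  have "(\<Sum>B\<in>Pow I. \<Sum>C\<in>Pow (I - B). G B C) = (\<Sum>(B, C)\<in>(SIGMA B:Pow I. Pow (I - B)). G B C)"
    using assms by (intro sum.Sigma) auto
  \<comment> \<open>Disjoint pairs \<open>(B, C)\<close> correspond to pairs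
    \<open>B \<subseteq> D\<close> by \<open>D = B \<union> C\<close> and
    \<open>C = D - B\<close>.\<close>
  also have "\<dots> = (\<Sum>(D, B)\<in>(SIGMA D:Pow I. Pow D). G B (D - B))"
    by (rule sum.reindex_bij_witness[of _ "\<lambda>(D, B). (B, D - B)" "\<lambda>(B, C). (B \<union> C, B)"])
       (auto intro!: arg_cong[where f = "G _"])
  also have "\<dots> = (\<Sum>D\<in>Pow I. \<Sum>B\<in>Pow D. G B (D - B))"
    using assms finite_subset by (intro sum.Sigma[symmetric]) auto
  finally show ?thesis .
qed

lemma sum_strata_weights:
  fixes q :: "'i \<Rightarrow> real" and d :: "'i set \<Rightarrow> real"
  assumes "finite I"
  shows "(\<Sum>B\<in>Pow I. (\<Sum>C\<in>Pow (I - B). (-1) ^ card C * d (B \<union> C)) * (\<Prod>i\<in>B. q i)) =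
    (\<Sum>D\<in>Pow I. (-1) ^ card D * d D * (\<Prod>i\<in>D. 1 - q i))"
proof -
  have "(\<Sum>B\<in>Pow I. (\<Sum>C\<in>Pow (I - B). (-1) ^ card C * d (B \<union> C)) * (\<Prod>i\<in>B. q i)) =
      (\<Sum>B\<in>Pow I. \<Sum>C\<in>Pow (I - B). (-1) ^ card C * d (B \<union> C) * (\<Prod>i\<in>B. q i))"
    by (simp only: sum_distrib_right)
  also have "\<dots> = (\<Sum>D\<in>Pow I. \<Sum>B\<in>Pow D. (-1) ^ card (D - B) * d (B \<union> (D - B)) * (\<Prod>i\<in>B. q i))"
    by (rule sum_disjoint_pairs[OF assms])
  also have "\<dots> = (\<Sum>D\<in>Pow I. (-1) ^ card D * d D * (\<Prod>i\<in>D. 1 - q i))"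
  proof (rule sum.cong[OF refl])
    fix D assume "D \<in> Pow I"
    then have fin: "finite D"
      using assms finite_subset by blast
    \<comment> \<open>One sign per factor turns \<open>1 - q i\<close> into
      \<open>q i + (-1)\<close>, which \<open>prod_add\<close> expands over the subsets of
      \<open>D\<close>.\<close>
    have "(-1) ^ card D * (\<Prod>i\<in>D. 1 - q i) = (\<Prod>i\<in>D. q i + (-1))"
      by (simp add: prod_uminus[symmetric])
    also have "\<dots> = (\<Sum>B\<in>Pow D. (\<Prod>i\<in>B. q i) * (-1) ^ card (D - B))"
      by (subst prod_add[OF fin]) simp
    finally have "(-1) ^ card D * d D * (\<Prod>i\<in>D. 1 - q i) =
        d D * (\<Sum>B\<in>Pow D. (\<Prod>i\<in>B. q i) * (-1) ^ card (D - B))"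
      by (simp add: mult_ac)
    also have "\<dots> = (\<Sum>B\<in>Pow D. (-1) ^ card (D - B) * d (B \<union> (D - B)) * (\<Prod>i\<in>B. q i))"
      unfolding sum_distrib_left by (intro sum.cong) (auto simp: Un_absorb1 mult_ac)
    finally show "(\<Sum>B\<in>Pow D. (-1) ^ card (D - B) * d (B \<union> (D - B)) * (\<Prod>i\<in>B. q i)) =
        (-1) ^ card D * d D * (\<Prod>i\<in>D. 1 - q i)" ..
  qed
  finally show ?thesis .
qed

lemma sum_Pow_by_card:
  fixes p :: "'i set \<Rightarrow> real"
  assumes "finite I"
  shows "(\<Sum>D\<in>Pow I. (-1) ^ card D * real (n + 1 - card D) * p D) =
    (\<Sum>j=0..n. (-1) ^ j * real (n + 1 - j) * (\<Sum>D | D \<subseteq> I \<and> card D = j. p D))"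
proof -
  let ?h = "\<lambda>D. (-1) ^ card D * real (n + 1 - card D) * p D"
  let ?S = "{D \<in> Pow I. card D \<le> n}"
  have fin: "finite (Pow I)"
    using assms by simp
  \<comment> \<open>For \<open>card D > n\<close> the truncated difference
    \<open>n + 1 - card D\<close> is 0.\<close>
  have "sum ?h (Pow I) = sum ?h ?S"
    using fin by (intro sum.mono_neutral_right) auto
  also have "\<dots> = (\<Sum>j=0..n. sum ?h {D. D \<in> ?S \<and> card D = j})"
    using fin by (intro sum.group[symmetric]) auto
  also have "\<dots> = (\<Sum>j=0..n. (-1) ^ j * real (n + 1 - j) * (\<Sum>D | D \<subseteq> I \<and> card D = j. p D))"
  proof (rule sum.cong[OF refl])
    fix j assume "j \<in> {0..n}"
    then have "{D. D \<in> ?S \<and> card D = j} = {D. D \<subseteq> I \<and> card D = j}"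
      by auto
    then show "sum ?h {D. D \<in> ?S \<and> card D = j} =
        (-1) ^ j * real (n + 1 - j) * (\<Sum>D | D \<subseteq> I \<and> card D = j. p D)"
      by (simp add: sum_distrib_left)
  qed
  finally show ?thesis .
qed

section \<open>Flats and strata in general position\<close>

locale arrangement_functionals =
  fixes n :: nat and I :: "'i set" and H :: "'i \<Rightarrow> (nat \<Rightarrow> complex) set set"
    and \<phi> :: "'i \<Rightarrow> (nat \<Rightarrow> complex) \<Rightarrow> complex"
  assumes finite_I: "finite I"
    and \<phi>: "\<And>i. i \<in> I \<Longrightarrow> cfunctional (\<phi> i)"
    and H_eq: "\<And>i. i \<in> I \<Longrightarrow> H i = {L \<in> cproj n. \<forall>z\<in>L. \<phi> i z = 0}"
    and general_position: "in_general_position n I H"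
begin

definition flat_space :: "'i set \<Rightarrow> (nat \<Rightarrow> complex) set"
  where "flat_space B = {z \<in> cspace (Suc n). \<forall>i\<in>B. \<phi> i z = 0}"

lemma flat_space_sub: "flat_space B \<subseteq> cspace (Suc n)"
  by (auto simp: flat_space_def)

lemma subspace_flat_space:
  assumes "B \<subseteq> I"
  shows "cvec.subspace (flat_space B)"
proof -
  have "finite B"
    using assms finite_I finite_subset by blast
  then show ?thesis
    using assms
  proof induction
    case empty
    then show ?case
      using subspace_cspace by (simp add: flat_space_def)
  next
    case (insert i B)
    have "flat_space (insert i B) = {z \<in> flat_space B. \<phi> i z = 0}"
      by (auto simp: flat_space_def)
    then show ?case
      using insert \<phi> by (simp add: subspace_kernel)
  qed
qed

lemma arrangement_flat_eq:
  assumes "B \<subseteq> I"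
  shows "arrangement_flat n H B = {L \<in> cproj n. L \<subseteq> flat_space B}"
proof -
  have "L \<in> H i \<longleftrightarrow> (\<forall>z\<in>L. \<phi> i z = 0)" if "L \<in> cproj n" "i \<in> B" for L i
    using assms that H_eq by auto
  moreover have "L \<subseteq> cspace (Suc n)" if "L \<in> cproj n" for L
    using that by (simp add: cproj_def)
  ultimately show ?thesis
    unfolding arrangement_flat_def flat_space_def by blast
qed

text \<open>Up to \<open>n\<close> hyperplanes this is the prescribed codimension. Beyond that,
  \<open>n + 1\<close> of them already have no common point, so the space is \<open>{0}\<close> and
  truncation gives the right value.\<close>

lemma dim_flat_space:
  assumes "B \<subseteq> I"
  shows "cvec.dim (flat_space B) = n + 1 - card B"
proof (cases "card B \<le> n")
  case True
  then have "linear_subspace_codim n (card B) (arrangement_flat n H B)"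
    using general_position assms by (simp only: in_general_position_def)
  then obtain V where V: "cvec.subspace V" "V \<subseteq> cspace (Suc n)" "cvec.dim V + card B = Suc n"
      "arrangement_flat n H B = {L \<in> cproj n. L \<subseteq> V}"
    unfolding linear_subspace_codim_def by blast
  have "V = flat_space B"
  proof
    show "V \<subseteq> flat_space B"
      using V(4) arrangement_flat_eq[OF assms]
      by (intro proj_subspace_mono[OF V(1,2) subspace_flat_space[OF assms]]) simp
    show "flat_space B \<subseteq> V"
      using V(4) arrangement_flat_eq[OF assms]
      by (intro proj_subspace_mono[OF subspace_flat_space[OF assms] flat_space_sub V(1)]) simp
  qed
  then show ?thesis
    using V(3) by simp
next
  case False
  then obtain C where C: "C \<subseteq> B" "card C = n + 1"
    using obtain_subset_with_card_n[of "n + 1" B] by auto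
  then have CI: "C \<subseteq> I"
    using assms by blast
  have "{L \<in> cproj n. L \<subseteq> flat_space C} = {}"
    using general_position C(2) CI unfolding in_general_position_def arrangement_flat_eq[OF CI, symmetric]
    by blast
  then have "flat_space C \<subseteq> {0}"
    by (intro proj_subspace_mono[OF subspace_flat_space[OF CI] flat_space_sub]) auto
  moreover have "flat_space B \<subseteq> flat_space C"
    using C(1) by (auto simp: flat_space_def)
  moreover have "0 \<in> flat_space B"
    using cvec.subspace_0[OF subspace_flat_space[OF assms]] .
  ultimately have "flat_space B = {0}"
    by blast
  then show ?thesis
    using False by (simp add: dim_zero_space)
qed

lemma arrangement_flat_empty_iff:
  assumes "B \<subseteq> I"
  shows "arrangement_flat n H B = {} \<longleftrightarrow> n < card B"
proof
  assume "arrangement_flat n H B = {}"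
  then have "flat_space B \<subseteq> {0}"
    using arrangement_flat_eq[OF assms]
    by (intro proj_subspace_mono[OF subspace_flat_space[OF assms] flat_space_sub]) auto
  then have "flat_space B = {0}"
    using cvec.subspace_0[OF subspace_flat_space[OF assms]] by blast
  then show "n < card B"
    using dim_flat_space[OF assms] by (simp add: dim_zero_space)
next
  assume "n < card B"
  then have dim: "cvec.dim (flat_space B) = 0"
    using dim_flat_space[OF assms] by simp
  obtain E where E: "E \<subseteq> flat_space B" "cvec.independent E" "flat_space B \<subseteq> cvec.span E" "card E = 0"
    using cvec.basis_exists[of "flat_space B"] dim by metis
  then have "E = {}"
    using independent_cspace(1)[OF E(2), of "Suc n"] E(1,4) flat_space_sub[of B] by auto
  then have "flat_space B \<subseteq> {0}"
    using E(3) by simp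
  moreover have "\<exists>z\<in>L. z \<noteq> 0" if "L \<in> cproj n" for L
  proof -
    obtain z where "z \<in> cspace (Suc n) - {0}" "L = cline z"
      using \<open>L \<in> cproj n\<close> cproj_eq_image_cline by blast
    then show ?thesis
      using cvec.span_base[of z "{z}"] by (auto simp: cline_def)
  qed
  ultimately show "arrangement_flat n H B = {}"
    unfolding arrangement_flat_eq[OF assms] by fast
qed

abbreviation stratum :: "'i set \<Rightarrow> (nat \<Rightarrow> complex) set set"
  where "stratum B \<equiv> proj_part n (flat_space B) \<phi> (I - B)"

text \<open>A point determines \<open>B\<close>. Hence different index sets have disjoint strata,
  and on \<open>stratum B\<close> the product defining \<open>b\<close> runs over
  \<open>B\<close>.\<close>

lemma stratum_memD:
  assumes "B \<subseteq> I" "L \<in> stratum B"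
  shows "{i \<in> I. L \<in> H i} = B"
proof -
  have L: "L \<in> cproj n" "L \<subseteq> flat_space B" "\<And>i. i \<in> I - B \<Longrightarrow> \<exists>z\<in>L. \<phi> i z \<noteq> 0"
    using assms(2) by (auto simp: proj_part_def)
  have "L \<in> H i \<longleftrightarrow> i \<in> B" if "i \<in> I" for i
  proof -
    have "L \<in> H i \<longleftrightarrow> (\<forall>z\<in>L. \<phi> i z = 0)"
      using H_eq[OF that] L(1) by simp
    then show ?thesis
      using L(2) L(3)[of i] that by (auto simp: flat_space_def)
  qed
  then show ?thesis
    using assms(1) by blast
qed

text \<open>A further hyperplane containing the flat would leave the dimension
  \<open>n + 1 - card B\<close> unchanged; with \<open>card B \<le> n\<close> that number is
  positive and must drop by one.\<close>

lemma arrangement_flat_subset_iff: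
  assumes B: "B \<subseteq> I" "card B \<le> n" and i: "i \<in> I"
  shows "arrangement_flat n H B \<subseteq> H i \<longleftrightarrow> i \<in> B"
proof
  assume sub: "arrangement_flat n H B \<subseteq> H i"
  show "i \<in> B"
  proof (rule ccontr)
    assume "i \<notin> B"
    have fin: "finite B"
      using B(1) finite_I finite_subset by blast
    have iB: "insert i B \<subseteq> I"
      using B i by blast
    have "arrangement_flat n H B = arrangement_flat n H (insert i B)"
      using sub by (auto simp: arrangement_flat_def)
    then have "flat_space B \<subseteq> flat_space (insert i B)"
      using arrangement_flat_eq[OF B(1)] arrangement_flat_eq[OF iB]
      by (intro proj_subspace_mono[OF subspace_flat_space[OF B(1)] flat_space_sub subspace_flat_space[OF iB]]) simp
    then have "flat_space B = flat_space (insert i B)"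
      by (auto simp: flat_space_def)
    then have "n + 1 - card B = n + 1 - card (insert i B)"
      using dim_flat_space[OF B(1)] dim_flat_space[OF iB] by simp
    moreover have "card (insert i B) = card B + 1"
      using \<open>i \<notin> B\<close> fin by simp
    ultimately show False
      using B(2) by linarith
  qed
qed (auto simp: arrangement_flat_def)

text \<open>The nonempty flats are those of at most \<open>n\<close> hyperplanes. Such a flat lies
  in no hyperplane besides its own, so exactly those indexed by \<open>I - B\<close> are
  removed.\<close>

lemma arrangement_strata_eq: "arrangement_strata n I H = stratum ` {B. B \<subseteq> I \<and> card B \<le> n}"
proof -
  have str: "arrangement_flat n H B - (\<Union>i\<in>{i\<in>I. \<not> arrangement_flat n H B \<subseteq> H i}. H i) = stratum B"
    if B: "B \<subseteq> I" "card B \<le> n" for B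
  proof -
    have "{i\<in>I. \<not> arrangement_flat n H B \<subseteq> H i} = I - B"
      using arrangement_flat_subset_iff[OF B] by blast
    then show ?thesis
      using H_eq unfolding arrangement_flat_eq[OF B(1)] by (auto simp: proj_part_def)
  qed
  have "arrangement_strata n I H =
      (\<lambda>B. arrangement_flat n H B - (\<Union>i\<in>{i\<in>I. \<not> arrangement_flat n H B \<subseteq> H i}. H i)) ` {B. B \<subseteq> I \<and> card B \<le> n}"
  proof -
    have "{B. B \<subseteq> I \<and> card B \<le> n} = {B. B \<subseteq> I \<and> arrangement_flat n H B \<noteq> {}}"
    proof (intro Collect_cong conj_cong refl)
      fix B assume "B \<subseteq> I"
      then show "card B \<le> n \<longleftrightarrow> arrangement_flat n H B \<noteq> {}"
        using arrangement_flat_empty_iff[of B] by linarith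
    qed
    moreover have "{F A |A. A \<noteq> {} \<and> (\<exists>B\<subseteq>I. A = X B)} = (\<lambda>B. F (X B)) ` {B. B \<subseteq> I \<and> X B \<noteq> {}}"
      for F :: "(nat \<Rightarrow> complex) set set \<Rightarrow> (nat \<Rightarrow> complex) set set" and X
      by blast
    ultimately show ?thesis
      unfolding arrangement_strata_def by (simp only:)
  qed
  also have "\<dots> = stratum ` {B. B \<subseteq> I \<and> card B \<le> n}"
    using str by (intro image_cong) auto
  finally show ?thesis .
qed

lemma euler_characteristic_stratum:
  assumes "B \<subseteq> I"
  shows "euler_characteristic (subtopology (CP n) (stratum B)) =
    (\<Sum>C\<in>Pow (I - B). (-1) ^ card C * int (n + 1 - card (B \<union> C)))"
proof -
  have "euler_characteristic (subtopology (CP n) (stratum B)) = alt_dim (flat_space B) \<phi> (I - B)"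
    using finite_I \<phi>
    by (intro has_euler_imp_euler_characteristic has_euler_proj_part subspace_flat_space[OF assms] flat_space_sub) auto
  also have "\<dots> = (\<Sum>C\<in>Pow (I - B). (-1) ^ card C * int (n + 1 - card (B \<union> C)))"
    unfolding alt_dim_def
  proof (rule sum.cong[OF refl])
    fix C assume C: "C \<in> Pow (I - B)"
    have "{z \<in> flat_space B. \<forall>j\<in>C. \<phi> j z = 0} = flat_space (B \<union> C)"
      by (auto simp: flat_space_def)
    moreover have "B \<union> C \<subseteq> I"
      using C assms by blast
    ultimately show "(-1) ^ card C * int (cvec.dim {z \<in> flat_space B. \<forall>j\<in>C. \<phi> j z = 0}) =
        (-1) ^ card C * int (n + 1 - card (B \<union> C))"
      using dim_flat_space by simp
  qed
  finally show ?thesis .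
qed

lemma orbifold_euler_number_arrangement:
  fixes m :: "'i \<Rightarrow> nat" and b :: "(nat \<Rightarrow> complex) set \<Rightarrow> nat"
  assumes b: "\<And>p. p \<in> cproj n \<Longrightarrow> b p = (\<Prod>i | i \<in> I \<and> p \<in> H i. m i)"
  shows "orbifold_euler_number (CP n) (arrangement_strata n I H) b =
    (\<Sum>j=0..n. (-1) ^ j * real (n + 1 - j) *
       (\<Sum>B | B \<subseteq> I \<and> card B = j. \<Prod>i\<in>B. 1 - 1 / real (m i)))"
proof -
  let ?e = "\<lambda>S. real_of_int (euler_characteristic (subtopology (CP n) S))"
  let ?\<B> = "{B. B \<subseteq> I \<and> card B \<le> n}"
  let ?q = "\<lambda>i. 1 / real (m i)"
  have fin: "finite ?\<B>"
    using finite_I by (auto intro: finite_subset[of _ "Pow I"])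
  have e_empty: "?e {} = 0"
    using has_euler_imp_euler_characteristic[OF has_euler_empty[of "subtopology (CP n) {}"]] by simp
  have e_stratum: "?e (stratum B) = (\<Sum>C\<in>Pow (I - B). (-1) ^ card C * real (n + 1 - card (B \<union> C)))"
    if "B \<subseteq> I" for B
    unfolding euler_characteristic_stratum[OF that] by simp
  have weight: "?e (stratum B) / real (the_elem (b ` stratum B)) = ?e (stratum B) * (\<Prod>i\<in>B. ?q i)"
    if B: "B \<subseteq> I" for B
  proof (cases "stratum B = {}")
    \<comment> \<open>\<open>the_elem\<close> is unspecified on the empty image, but the numerator
      is 0.\<close>
    case True
    then show ?thesis
      using e_empty by simp
  next
    case False
    have "b L = (\<Prod>i\<in>B. m i)" if L: "L \<in> stratum B" for L
      using b[of L] stratum_memD[OF B L] L by (auto simp: proj_part_def)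
    then have "b ` stratum B = {\<Prod>i\<in>B. m i}"
      using False by auto
    then show ?thesis
      by (simp add: prod_dividef)
  qed
  have "orbifold_euler_number (CP n) (arrangement_strata n I H) b =
      (\<Sum>B\<in>?\<B>. ?e (stratum B) / real (the_elem (b ` stratum B)))"
    unfolding orbifold_euler_number_def arrangement_strata_eq
  proof (subst sum.reindex_nontrivial[OF fin]) \<comment> \<open>an empty stratum contributes \<open>0\<close>, so nonemptiness is irrelevant\<close>
    fix B C assume B: "B \<in> ?\<B>" and C: "C \<in> ?\<B>" and ne: "B \<noteq> C" and eq: "stratum B = stratum C"
    have "stratum B = {}"
    proof (rule ccontr)
      assume "stratum B \<noteq> {}"
      then obtain L where "L \<in> stratum B" "L \<in> stratum C"
        using eq by blast
      then show False
        using stratum_memD[of B L] stratum_memD[of C L] B C ne by blast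
    qed
    then show "?e (stratum B) / real (the_elem (b ` stratum B)) = 0"
      using e_empty by simp
  qed simp
  also have "\<dots> = (\<Sum>B\<in>?\<B>. (\<Sum>C\<in>Pow (I - B). (-1) ^ card C * real (n + 1 - card (B \<union> C))) * (\<Prod>i\<in>B. ?q i))"
    using weight e_stratum by (intro sum.cong) auto
  \<comment> \<open>The sum can be extended to all subsets of \<open>I\<close>: for
    \<open>card B > n\<close> every truncated dimension in the inner sum is 0.\<close>
  also have "\<dots> = (\<Sum>B\<in>Pow I. (\<Sum>C\<in>Pow (I - B). (-1) ^ card C * real (n + 1 - card (B \<union> C))) * (\<Prod>i\<in>B. ?q i))"
  proof (rule sum.mono_neutral_left)
    show "\<forall>B\<in>Pow I - ?\<B>. (\<Sum>C\<in>Pow (I - B). (-1) ^ card C * real (n + 1 - card (B \<union> C))) * (\<Prod>i\<in>B. ?q i) = 0"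
    proof
      fix B assume B: "B \<in> Pow I - ?\<B>"
      have "n + 1 - card (B \<union> C) = 0" if "C \<in> Pow (I - B)" for C
      proof -
        have "finite (B \<union> C)"
          using B that finite_I finite_subset[of "B \<union> C" I] by blast
        then have "card B \<le> card (B \<union> C)"
          by (intro card_mono) auto
        moreover have "n < card B"
          using B by auto
        ultimately show ?thesis
          by linarith
      qed
      then have "(\<Sum>C\<in>Pow (I - B). (-1) ^ card C * real (n + 1 - card (B \<union> C))) = 0"
        by (intro sum.neutral) simp
      then show "(\<Sum>C\<in>Pow (I - B). (-1) ^ card C * real (n + 1 - card (B \<union> C))) * (\<Prod>i\<in>B. ?q i) = 0"
        by simp
    qed
  qed (use finite_I in auto)
  also have "\<dots> = (\<Sum>D\<in>Pow I. (-1) ^ card D * real (n + 1 - card D) * (\<Prod>i\<in>D. 1 - ?q i))"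
    by (rule sum_strata_weights[OF finite_I])
  also have "\<dots> = (\<Sum>j=0..n. (-1) ^ j * real (n + 1 - j) * (\<Sum>B | B \<subseteq> I \<and> card B = j. \<Prod>i\<in>B. 1 - ?q i))"
    by (rule sum_Pow_by_card[OF finite_I])
  finally show ?thesis .
qed

end

lemma ex_arrangement_functionals:
  assumes "hyperplane_arrangement n I H" "in_general_position n I H"
  shows "\<exists>\<phi>. arrangement_functionals n I H \<phi>"
proof -
  have "\<forall>i\<in>I. \<exists>f. cfunctional f \<and> H i = {L \<in> cproj n. \<forall>z\<in>L. f z = 0}"
  proof
    fix i assume "i \<in> I"
    then have "linear_subspace_codim n 1 (H i)"
      using assms by (simp add: hyperplane_arrangement_def)
    then show "\<exists>f. cfunctional f \<and> H i = {L \<in> cproj n. \<forall>z\<in>L. f z = 0}"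
      using hyperplane_functional by blast
  qed
  then obtain \<phi> where \<phi>: "\<forall>i\<in>I. cfunctional (\<phi> i) \<and> H i = {L \<in> cproj n. \<forall>z\<in>L. \<phi> i z = 0}"
    by (rule bchoice[THEN exE])
  have "finite I"
    using assms(1) by (simp add: hyperplane_arrangement_def)
  then have "arrangement_functionals n I H \<phi>"
    using \<phi> assms(2) by (intro arrangement_functionals.intro) blast+
  then show ?thesis
    by blast
qed

theorem proposition1:
  fixes n r :: nat
    and b :: "(nat \<Rightarrow> complex) set \<Rightarrow> nat"
    and H :: "nat \<Rightarrow> (nat \<Rightarrow> complex) set set"
    and m :: "nat \<Rightarrow> nat"
    and s :: "nat \<Rightarrow> real"
  assumes "projective_orbifold n b"
    and "hyperplane_arrangement n {1..r} H"
    and "in_general_position n {1..r} H"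
    and "orbifold_locus n b = (\<Union>i\<in>{1..r}. H i)"
    and "\<forall>i\<in>{1..r}. m i > 0"
    and "\<forall>p\<in>cproj n. b p = (\<Prod>i | i \<in> {1..r} \<and> p \<in> H i. m i)"
    and "\<forall>i\<in>{1..r}. s i = 1 - 1 / real (m i)"
  shows "orbifold_euler_number (CP n) (arrangement_strata n {1..r} H) b =
    (\<Sum>j=0..n. (-1) ^ j * real (n + 1 - j) *
       (\<Sum>B | B \<subseteq> {1..r} \<and> card B = j. \<Prod>i\<in>B. s i))"
proof -
  obtain \<phi> where "arrangement_functionals n {1..r} H \<phi>"
    using ex_arrangement_functionals[OF assms(2,3)] by blast
  then interpret arrangement_functionals n "{1..r}" H \<phi> .
  have "orbifold_euler_number (CP n) (arrangement_strata n {1..r} H) b =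
    (\<Sum>j=0..n. (-1) ^ j * real (n + 1 - j) *
       (\<Sum>B | B \<subseteq> {1..r} \<and> card B = j. \<Prod>i\<in>B. 1 - 1 / real (m i)))"
    using assms(6) by (intro orbifold_euler_number_arrangement) blast
  also have "\<dots> = (\<Sum>j=0..n. (-1) ^ j * real (n + 1 - j) *
       (\<Sum>B | B \<subseteq> {1..r} \<and> card B = j. \<Prod>i\<in>B. s i))"
  proof (intro sum.cong refl arg_cong2[where f = "(*)"] prod.cong)
    show "1 - 1 / real (m i) = s i" if "B \<in> {B. B \<subseteq> {1..r} \<and> card B = j}" "i \<in> B" for j B i
      using assms(7) that by auto
  qed
  finally show ?thesis .
qed

end
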